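(* Fix an equation $(f,q,w)$ as in the context. For $a_{12},b_{21}\in\mathbb R$ and a fixed $z\in\mathbb C$ let $\mathbf A(a_{12},b_{21})$ be the self-adjoint boundary condition with coefficient matrix $\begin{pmatrix}1&a_{12}&\bar z&0\\0&z&b_{21}&1\end{pmatrix}$, and let $\mathbf S_1=\begin{pmatrix}0&1&0&0\\0&0&b_{21}&1\end{pmatrix}$, $\mathbf S_2=\begin{pmatrix}1&a_{12}&0&0\\0&0&1&0\end{pmatrix}$. Then the problem with $\mathbf A(a_{12},b_{21})$ has exactly $N$ eigenvalues if $a_{12}\ne1/f_0$ and exactly $N-1$ if $a_{12}=1/f_0$; with $\mathbf S_1$ it has exactly $N$ eigenvalues; with $\mathbf S_2$ it has exactly $N-1$ eigenvalues if $a_{12}\neq1/f_0$ and exactly $N-2$ if $a_{12}=1/f_0$. Further: (i) fix $b_{21}$ and let $a^{(1)}<a^{(2)}\le1/f_0<a^{(3)}<a^{(4)}$; writing $\lambda_n(a^{(i)})$ for the eigenvalues with $\mathbf A(a^{(i)},b_{21})$ and $\lambda_n(\mathbf S_1)$ for those with $\mathbf S_1$: for each $0\le n\le N-2$, $\lambda_n(a^{(3)})\le\lambda_n(a^{(4)})\le\lambda_n(\mathbf S_1)\le\lambda_n(a^{(1)})\le\lambda_n(a^{(2)})\le\lambda_{n+1}(a^{(3)})$, and $\lambda_{N-1}(a^{(3)})\le\lambda_{N-1}(a^{(4)})\le\lambda_{N-1}(\mathbf S_1)\le\lambda_{N-1}(a^{(1)})$; in addition $\lambda_{N-1}(a^{(1)})\le\lambda_{N-1}(a^{(2)})$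 if $a^{(2)}<1/f_0$; (ii) fix $a_{12}$ and let $b^{(1)}<b^{(2)}$; writing $\lambda_n(b^{(j)})$ for the eigenvalues with $\mathbf A(a_{12},b^{(j)})$ and $\lambda_n(\mathbf S_2)$ for those with $\mathbf S_2$: for each $0\le n\le N-3$, $\lambda_n(b^{(1)})\le\lambda_n(b^{(2)})\le\lambda_n(\mathbf S_2)\le\lambda_{n+1}(b^{(1)})$, and $\lambda_{N-2}(b^{(1)})\le\lambda_{N-2}(b^{(2)})$; in addition, if $a_{12}\neq1/f_0$, then $\lambda_{N-2}(b^{(2)})\le\lambda_{N-2}(\mathbf S_2)\le\lambda_{N-1}(b^{(1)})\le\lambda_{N-1}(b^{(2)})$.
   Context: Let $N\ge2$ be an integer. An equation is given by real sequences $f=\{f_n\}_{n=0}^N$, $q=\{q_n\}_{n=1}^N$, $w=\{w_n\}_{n=1}^N$ with $f_n\neq0$, $w_n>0$; it is $-\nabla(f_n\Delta y_n)+q_ny_n=\lambda w_ny_n$, $1\le n\le N$, for $y=\{y_n\}_{n=0}^{N+1}$, $\Delta y_n=y_{n+1}-y_n$, $\nabla y_n=y_n-y_{n-1}$. A boundary condition with $2\times4$ coefficient matrix $(A,B)$ (rank 2) is $A(y_0,f_0\Delta y_0)^T+B(y_N,f_N\Delta y_N)^T=0$; matrices differing by left multiplication by an invertible $2\times2$ complex matrix give the same condition. Eigenvalues ($\lambda$ with a nontrivial solution) of a self-adjoint problem are real; multiplicity = dimension of the solution space (equal to the multiplicity as a zero of the characteristic polynomial); counted with multiplicity they are ordered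 $\lambda_0\le\lambda_1\le\cdots$, and "exactly $k$ eigenvalues" counts multiplicity. *)

theory Defs
  imports "HOL-Analysis.Analysis" "HOL-Library.Function_Algebras"
begin

text \<open>Discrete Sturm--Liouville problem
  -nabla(f_n Delta y_n) + q_n y_n = lambda w_n y_n, 1 <= n <= N,
  with boundary condition A (y_0, f_0 Delta y_0)^T + B (y_N, f_N Delta y_N)^T = 0.
  A 2x4 coefficient matrix (A,B) is represented as a function M i j (i < 2, j < 4).
  Solutions y are sequences y_0, ..., y_{N+1}, represented as functions nat => complex
  that vanish beyond N+1.\<close>

definition sl_eq :: "(nat \<Rightarrow> real) \<Rightarrow> (nat \<Rightarrow> real) \<Rightarrow> (nat \<Rightarrow> real) \<Rightarrow> nat
    \<Rightarrow> complex \<Rightarrow> (nat \<Rightarrow> complex) \<Rightarrow> bool" where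
  "sl_eq f q w N lam y \<longleftrightarrow>
     (\<forall>n\<in>{1..N}.
        - (of_real (f n) * (y (n+1) - y n) - of_real (f (n-1)) * (y n - y (n-1)))
        + of_real (q n) * y n = lam * of_real (w n) * y n)"

definition bc_holds :: "(nat \<Rightarrow> nat \<Rightarrow> complex) \<Rightarrow> (nat \<Rightarrow> real) \<Rightarrow> nat
    \<Rightarrow> (nat \<Rightarrow> complex) \<Rightarrow> bool" where
  "bc_holds M f N y \<longleftrightarrow>
     (\<forall>i<2. M i 0 * y 0 + M i 1 * (of_real (f 0) * (y 1 - y 0))
            + M i 2 * y N + M i 3 * (of_real (f N) * (y (N+1) - y N)) = 0)"

definition sol_space :: "(nat \<Rightarrow> real) \<Rightarrow> (nat \<Rightarrow> real) \<Rightarrow> (nat \<Rightarrow> real) \<Rightarrow> nat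
    \<Rightarrow> (nat \<Rightarrow> nat \<Rightarrow> complex) \<Rightarrow> complex \<Rightarrow> (nat \<Rightarrow> complex) set" where
  "sol_space f q w N M lam =
     {y. (\<forall>n>N+1. y n = 0) \<and> sl_eq f q w N lam y \<and> bc_holds M f N y}"

definition is_eigenvalue :: "(nat \<Rightarrow> real) \<Rightarrow> (nat \<Rightarrow> real) \<Rightarrow> (nat \<Rightarrow> real) \<Rightarrow> nat
    \<Rightarrow> (nat \<Rightarrow> nat \<Rightarrow> complex) \<Rightarrow> complex \<Rightarrow> bool" where
  "is_eigenvalue f q w N M lam \<longleftrightarrow> (\<exists>y\<in>sol_space f q w N M lam. y \<noteq> 0)"

definition eig_mult :: "(nat \<Rightarrow> real) \<Rightarrow> (nat \<Rightarrow> real) \<Rightarrow> (nat \<Rightarrow> real) \<Rightarrow> nat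
    \<Rightarrow> (nat \<Rightarrow> nat \<Rightarrow> complex) \<Rightarrow> complex \<Rightarrow> nat" where
  "eig_mult f q w N M lam =
     Vector_Spaces.vector_space.dim (\<lambda>(c::complex) (y::nat \<Rightarrow> complex). (\<lambda>n. c * y n))
       (sol_space f q w N M lam)"

definition has_exactly_eigs :: "(nat \<Rightarrow> real) \<Rightarrow> (nat \<Rightarrow> real) \<Rightarrow> (nat \<Rightarrow> real) \<Rightarrow> nat
    \<Rightarrow> (nat \<Rightarrow> nat \<Rightarrow> complex) \<Rightarrow> nat \<Rightarrow> bool" where
  "has_exactly_eigs f q w N M k \<longleftrightarrow>
     finite {e. is_eigenvalue f q w N M e} \<and>
     (\<Sum>e\<in>{e. is_eigenvalue f q w N M e}. eig_mult f q w N M e) = k"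

definition eig_count_le :: "(nat \<Rightarrow> real) \<Rightarrow> (nat \<Rightarrow> real) \<Rightarrow> (nat \<Rightarrow> real) \<Rightarrow> nat
    \<Rightarrow> (nat \<Rightarrow> nat \<Rightarrow> complex) \<Rightarrow> real \<Rightarrow> nat" where
  "eig_count_le f q w N M x =
     (\<Sum>\<mu>\<in>{\<mu>::real. is_eigenvalue f q w N M (of_real \<mu>) \<and> \<mu> \<le> x}.
        eig_mult f q w N M (of_real \<mu>))"

text \<open>The n-th eigenvalue lambda_n (n = 0, 1, ...) in the nondecreasing ordering
  of the (real) eigenvalues repeated according to multiplicity.\<close>
definition eig :: "(nat \<Rightarrow> real) \<Rightarrow> (nat \<Rightarrow> real) \<Rightarrow> (nat \<Rightarrow> real) \<Rightarrow> nat
    \<Rightarrow> (nat \<Rightarrow> nat \<Rightarrow> complex) \<Rightarrow> nat \<Rightarrow> real" where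
  "eig f q w N M n =
     Min {x::real. is_eigenvalue f q w N M (of_real x) \<and> n < eig_count_le f q w N M x}"

definition bcA :: "real \<Rightarrow> real \<Rightarrow> complex \<Rightarrow> nat \<Rightarrow> nat \<Rightarrow> complex" where
  "bcA a12 b21 z i j = [[1, of_real a12, cnj z, 0], [0, z, of_real b21, 1]] ! i ! j"

definition bcS1 :: "real \<Rightarrow> nat \<Rightarrow> nat \<Rightarrow> complex" where
  "bcS1 b21 i j = [[0, 1, 0, 0], [0, 0, of_real b21, 1]] ! i ! j"

definition bcS2 :: "real \<Rightarrow> nat \<Rightarrow> nat \<Rightarrow> complex" where
  "bcS2 a12 i j = [[1, of_real a12, 0, 0], [0, 0, 1, 0]] ! i ! j"

end

theory Submission
  imports Defs
begin

text \<open>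
  Write \<open>u = f\<^sub>0 \<Delta>y\<^sub>0\<close> and \<open>g = f\<^sub>N \<Delta>y\<^sub>N\<close>. Each boundary condition has the form
  \<open>u = c (y\<^sub>1 + cnj z y\<^sub>N)\<close>, \<open>g + z u + b y\<^sub>N = 0\<close> with \<open>c, b \<in> (-\<infinity>, \<infinity>]\<close>, where an infinite strength stands
  for \<open>y\<^sub>1 + cnj z y\<^sub>N = 0\<close>, respectively \<open>y\<^sub>N = 0\<close>: for the first family \<open>c = 1 / (1 / f\<^sub>0 - a\<^sub>1\<^sub>2)\<close> and
  \<open>b = b\<^sub>2\<^sub>1\<close>, while \<open>S\<^sub>1\<close> is \<open>c = 0\<close> and \<open>S\<^sub>2\<close> is \<open>b = \<infinity>\<close>. By summation by parts the eigenvalues are those of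
  \[ Q(y) = \sum_{n=1}^{N-1} f_n |\Delta y_n|^2 + \sum_{n=1}^N q_n |y_n|^2
     + c\, |y_1 + \bar z y_N|^2 + b\, |y_N|^2 \]
  relative to the weight \<open>w\<close>, on the subspace of \<open>\<complex>\<^sup>N\<close> cut out by the infinite strengths. Their number is
  the dimension of that subspace, and by the Courant--Fischer principle they increase with \<open>c\<close> and
  \<open>b\<close>. Two strengths \<open>c\<close> (or \<open>b\<close>) give the same \<open>Q\<close> on a hyperplane, so their eigenvalues interlace.
\<close>

section \<open>Finite-dimensional subspaces\<close>

lemma (in Vector_Spaces.linear) dim_inj_image:
  assumes "vs1.subspace S" "inj_on f S"
  shows "vs2.dim (f ` S) = vs1.dim S"
proof -
  obtain B where B: "B \<subseteq> S" "vs1.independent B" "S \<subseteq> vs1.span B" "card B = vs1.dim S"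
    by (rule vs1.basis_exists)
  then have "vs1.span B = S"
    using assms(1) by (intro vs1.span_subspace)
  then have "vs2.independent (f ` B)"
    using independent_injective_image[OF B(2)] assms(2) by simp
  then have "card (f ` B) = vs2.dim (f ` S)"
    using B(1) spans_image[OF B(3)] by (intro vs2.basis_card_eq_dim) auto
  moreover have "card (f ` B) = card B"
    using inj_on_subset[OF assms(2) B(1)] by (rule card_image)
  ultimately show ?thesis
    using B(4) by simp
qed

context vector_space
begin

lemma dim_hyperplane:
  assumes "Vector_Spaces.linear scale (*) l"
    and S: "subspace S" "S \<subseteq> span T" "finite T"
  shows "dim S = dim {x \<in> S. l x = 0} + of_bool (\<exists>v\<in>S. l v \<noteq> 0)"
proof (cases "\<exists>v\<in>S. l v \<noteq> 0")
  case False
  then have "{x \<in> S. l x = 0} = S" by auto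
  then show ?thesis using False by simp
next
  case True
  then obtain v where v: "v \<in> S" "l v \<noteq> 0" by blast
  interpret l: Vector_Spaces.linear scale "(*)" l by fact
  let ?K = "{x \<in> S. l x = 0}"
  have "subspace ?K"
    using S(1) by (auto simp: subspace_def l.add l.scale)
  obtain B where B: "B \<subseteq> ?K" "independent B" "?K \<subseteq> span B" "card B = dim ?K"
    by (rule basis_exists)
  have "finite B"
    using independent_span_bound[OF S(3) B(2)] B(1) S(2) by blast
  have "span B \<subseteq> ?K"
    using B(1) \<open>subspace ?K\<close> by (rule span_minimal)
  then have v_notin: "v \<notin> span B" using v by auto
  have "S \<subseteq> span (insert v B)"
  proof
    fix x assume "x \<in> S"
    then have "x - scale (l x / l v) v \<in> ?K"
      using v S(1) by (simp add: subspace_diff subspace_scale l.diff l.scale)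
    then show "x \<in> span (insert v B)"
      using B(3) span_breakdown_eq by blast
  qed
  moreover have "independent (insert v B)"
    using B(2) v_notin by (simp add: independent_insert)
  ultimately have "card (insert v B) = dim S"
    using B(1) v by (intro basis_card_eq_dim) auto
  moreover have "v \<notin> B"
    using v_notin span_base by blast
  ultimately show ?thesis
    using \<open>finite B\<close> B(4) True by simp
qed

end

section \<open>Hermitian forms\<close>

locale hermitian_form = vector_space scale
  for scale :: "complex \<Rightarrow> 'a::ab_group_add \<Rightarrow> 'a" +
  fixes H :: "'a \<Rightarrow> 'a \<Rightarrow> complex"
  assumes add_left: "H (u + v) x = H u x + H v x"
    and scale_left: "H (scale c u) x = c * H u x"
    and hermitian: "H x u = cnj (H u x)"
begin

sublocale left: Vector_Spaces.linear scale "(*)" "\<lambda>u. H u x" for x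
  by unfold_locales (simp_all add: add_left scale_left algebra_simps)

lemma add_right: "H x (u + v) = H x u + H x v"
  using hermitian[of x] by (simp add: add_left)

lemma scale_right: "H x (scale c u) = cnj c * H x u"
  using hermitian[of x] by (simp add: scale_left)

lemma sum_right: "H x (\<Sum>i\<in>I. g i) = (\<Sum>i\<in>I. H x (g i))"
  by (subst (1 2) hermitian) (simp add: left.sum)

lemma of_real_Re_diag: "of_real (Re (H x x)) = H x x"
  using hermitian[of x x] by (metis Reals_cnj_iff of_real_Re)

lemma diag_scale: "H (scale c v) (scale c v) = of_real ((cmod c)\<^sup>2) * H v v"
  by (simp add: scale_left scale_right complex_norm_square del: of_real_power)

lemma diag_add_scale:
  "Re (H (v + scale s u) (v + scale s u)) =
     Re (H v v) + 2 * Re (cnj s * H v u) + (cmod s)\<^sup>2 * Re (H u u)"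
proof -
  have "H (v + scale s u) (v + scale s u) =
      H v v + (cnj s * H v u + cnj (cnj s * H v u)) + H (scale s u) (scale s u)"
    by (simp add: add_left add_right scale_left scale_right distrib_left hermitian[of u v])
  then show ?thesis
    by (simp add: diag_scale complex_add_cnj)
qed

lemma nonneg_on_line_null_orthogonal:
  assumes nonneg: "\<And>s. 0 \<le> Re (H (v + scale s u) (v + scale s u))" "0 \<le> Re (H u u)"
    and null: "H v v = 0"
  shows "H v u = 0"
proof (rule ccontr)
  assume "H v u \<noteq> 0"
  \<comment> \<open>A short step from \<open>v\<close> against the gradient \<open>H v u\<close> would make the form negative.\<close>
  define t where "t = 1 / (1 + Re (H u u))"
  let ?s = "of_real (- t) * H v u"
  have "t > 0" "t * Re (H u u) < 2"
    using nonneg(2) by (simp_all add: t_def divide_simps)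
  have "cnj ?s * H v u = of_real (- t * (cmod (H v u))\<^sup>2)"
    by (simp only: complex_norm_square of_real_mult complex_cnj_mult complex_cnj_complex_of_real mult_ac)
  then have cross_term: "Re (cnj ?s * H v u) = - t * (cmod (H v u))\<^sup>2"
    by (simp only: Re_complex_of_real)
  have "Re (H (v + scale ?s u) (v + scale ?s u)) = t * (cmod (H v u))\<^sup>2 * (t * Re (H u u) - 2)"
    unfolding diag_add_scale null cross_term
    by (simp add: norm_mult power_mult_distrib algebra_simps power2_eq_square)
  also have "\<dots> < 0"
    using \<open>t > 0\<close> \<open>t * Re (H u u) < 2\<close> \<open>H v u \<noteq> 0\<close> by (intro mult_pos_neg) auto
  finally show False
    using nonneg(1)[of ?s] by simp
qed

end

context
  fixes scale :: "complex \<Rightarrow> 'a::ab_group_add \<Rightarrow> 'a"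
begin

lemma hermitian_form_add:
  assumes "hermitian_form scale P" "hermitian_form scale Q"
  shows "hermitian_form scale (\<lambda>u v. P u v + Q u v)"
proof -
  interpret P: hermitian_form scale P by fact
  interpret Q: hermitian_form scale Q by fact
  show ?thesis
    by unfold_locales (simp_all add: P.add_left Q.add_left P.scale_left Q.scale_left distrib_left
        flip: P.hermitian Q.hermitian)
qed

lemma hermitian_form_sum:
  assumes "vector_space scale" "\<And>i. i \<in> I \<Longrightarrow> hermitian_form scale (P i)"
  shows "hermitian_form scale (\<lambda>u v. \<Sum>i\<in>I. P i u v)"
proof -
  interpret vector_space scale by fact
  have zero: "hermitian_form scale (\<lambda>u v. 0)"
    by unfold_locales simp_all
  show ?thesis
    using assms(2)
  proof (induction I rule: infinite_finite_induct)
    case (insert i I)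
    then show ?case
      using hermitian_form_add[of "P i" "\<lambda>u v. \<Sum>i\<in>I. P i u v"] by simp
  qed (simp_all add: zero)
qed

lemma hermitian_form_scaled:
  assumes "hermitian_form scale P"
  shows "hermitian_form scale (\<lambda>u v. of_real r * P u v)"
proof -
  interpret P: hermitian_form scale P by fact
  show ?thesis
    by unfold_locales (simp_all add: P.add_left P.scale_left distrib_left flip: P.hermitian)
qed

lemma hermitian_form_rank_one:
  assumes "Vector_Spaces.linear scale (*) l"
  shows "hermitian_form scale (\<lambda>u v. l u * cnj (l v))"
proof -
  interpret l: Vector_Spaces.linear scale "(*)" l by fact
  show ?thesis
    by unfold_locales (simp_all add: l.add l.scale distrib_right)
qed

end

section \<open>Orthonormal bases\<close>

lemma continuous_on_coordinate [continuous_intros]: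
  "continuous_on S (\<lambda>c::'i \<Rightarrow> 'b::topological_space. c i)"
  by (rule continuous_on_subset[OF continuous_on_product_coordinates]) simp

definition coordinate_sphere :: "'i set \<Rightarrow> ('i \<Rightarrow> 'b::real_normed_vector) set" where
  "coordinate_sphere B = {c. (\<forall>i. i \<notin> B \<longrightarrow> c i = 0) \<and> (\<Sum>i\<in>B. (norm (c i))\<^sup>2) = 1}"

lemma compact_coordinate_sphere:
  fixes B :: "'i set"
  assumes "finite B"
  shows "compact (coordinate_sphere B :: ('i \<Rightarrow> 'b::{real_normed_vector,heine_borel}) set)"
proof -
  define box :: "('i \<Rightarrow> 'b) set" where "box = (\<Pi>\<^sub>E i\<in>UNIV. if i \<in> B then cball 0 1 else {0})"
  have "compactin (product_topology (\<lambda>i. euclidean) UNIV) box"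
    unfolding box_def by (subst compactin_PiE) auto
  then have "compact box"
    by (simp add: euclidean_product_topology)
  moreover have "closed {c::'i \<Rightarrow> 'b. (\<Sum>i\<in>B. (norm (c i))\<^sup>2) = 1}"
    by (intro closed_Collect_eq continuous_intros)
  moreover have "coordinate_sphere B = box \<inter> {c. (\<Sum>i\<in>B. (norm (c i))\<^sup>2) = 1}"
  proof -
    have "norm (c i) \<le> 1" if "(\<Sum>i\<in>B. (norm (c i))\<^sup>2) = 1" "i \<in> B" for c :: "'i \<Rightarrow> 'b" and i
    proof -
      have "(norm (c i))\<^sup>2 \<le> (\<Sum>i\<in>B. (norm (c i))\<^sup>2)"
        using \<open>i \<in> B\<close> assms by (intro member_le_sum) auto
      then show ?thesis
        using that(1) by (simp add: abs_square_le_1)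
    qed
    then show ?thesis
      by (auto simp: box_def coordinate_sphere_def PiE_iff split: if_splits)
  qed
  ultimately show ?thesis
    by (simp add: compact_Int_closed)
qed

locale unitary_space = hermitian_form scale W
  for scale :: "complex \<Rightarrow> 'a::ab_group_add \<Rightarrow> 'a" and W +
  fixes V :: "'a set"
  assumes subspace_V: "subspace V"
    and finite_spanning_set: "\<exists>T. finite T \<and> V \<subseteq> span T"
    and positive_definite: "v \<in> V \<Longrightarrow> v \<noteq> 0 \<Longrightarrow> 0 < Re (W v v)"
begin

definition orthonormal :: "'a set \<Rightarrow> bool" where
  "orthonormal B \<longleftrightarrow> B \<subseteq> V \<and> (\<forall>a\<in>B. \<forall>b\<in>B. W a b = of_bool (a = b))"

definition orthonormal_basis :: "'a set \<Rightarrow> bool" where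
  "orthonormal_basis B \<longleftrightarrow> orthonormal B \<and> V \<subseteq> span B"

definition orthogonal_complement :: "'a set \<Rightarrow> 'a set" where
  "orthogonal_complement B = {x \<in> V. \<forall>b\<in>B. W x b = 0}"

definition projection :: "'a set \<Rightarrow> 'a \<Rightarrow> 'a" where
  "projection B x = (\<Sum>b\<in>B. scale (W x b) b)"

lemma orthonormal_subset: "orthonormal B \<Longrightarrow> A \<subseteq> B \<Longrightarrow> orthonormal A"
  unfolding orthonormal_def by blast

lemma coefficient_sum_orthonormal:
  assumes "orthonormal B" "finite B" "b \<in> B"
  shows "W (\<Sum>a\<in>B. scale (c a) a) b = c b"
proof -
  have "W (\<Sum>a\<in>B. scale (c a) a) b = (\<Sum>a\<in>B. if a = b then c a else 0)"
    unfolding left.sum left.scale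
    using assms by (intro sum.cong) (auto simp: orthonormal_def)
  then show ?thesis
    using assms by simp
qed

lemma diag_sum_orthonormal:
  assumes "orthonormal B" "finite B"
  shows "W (\<Sum>b\<in>B. scale (c b) b) (\<Sum>b\<in>B. scale (c b) b) = of_real (\<Sum>b\<in>B. (cmod (c b))\<^sup>2)"
    (is "W ?v ?v = _")
proof -
  have "W ?v ?v = (\<Sum>b\<in>B. c b * W b ?v)"
    by (simp only: left.sum left.scale)
  also have "\<dots> = (\<Sum>b\<in>B. c b * cnj (c b))"
    using assms by (simp add: hermitian[of _ ?v] coefficient_sum_orthonormal)
  finally show ?thesis
    by (simp add: complex_norm_square del: of_real_power)
qed

lemma sum_orthonormal_in_V: "orthonormal B \<Longrightarrow> (\<Sum>b\<in>B. scale (c b) b) \<in> V"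
  using subspace_V by (auto simp: orthonormal_def intro!: subspace_sum subspace_scale)

lemma independent_orthonormal:
  assumes "orthonormal B"
  shows "independent B"
proof -
  have "c v = 0" if "finite A" "A \<subseteq> B" "(\<Sum>a\<in>A. scale (c a) a) = 0" "v \<in> A" for A c v
    using coefficient_sum_orthonormal[OF orthonormal_subset[OF assms], of A v c] that by simp
  then show ?thesis
    unfolding independent_explicit_module by blast
qed

lemma orthonormal_bound: "\<exists>k. \<forall>B. orthonormal B \<longrightarrow> finite B \<and> card B \<le> k"
proof -
  obtain T where "finite T" "V \<subseteq> span T"
    using finite_spanning_set by blast
  then show ?thesis
    using independent_span_bound[OF _ independent_orthonormal] by (meson orthonormal_def order_trans)
qed

lemma finite_orthonormal: "orthonormal B \<Longrightarrow> finite B"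
  using orthonormal_bound by blast

lemma subspace_orthogonal_complement: "subspace (orthogonal_complement B)"
  using subspace_V by (auto simp: subspace_def orthogonal_complement_def left.add left.scale)

lemma linear_projection: "Vector_Spaces.linear scale scale (projection B)"
  by unfold_locales
    (simp_all add: projection_def left.add left.scale scale_left_distrib sum.distrib scale_sum_right)

lemma projection_in_span: "projection B x \<in> span B"
  unfolding projection_def by (intro span_sum span_scale span_base)

lemma coefficient_projection: "orthonormal B \<Longrightarrow> b \<in> B \<Longrightarrow> W (projection B x) b = W x b"
  unfolding projection_def by (intro coefficient_sum_orthonormal finite_orthonormal)

lemma diff_projection_in_complement:
  assumes "orthonormal B" "x \<in> V"
  shows "x - projection B x \<in> orthogonal_complement B"
proof -
  have "projection B x \<in> V"
    unfolding projection_def using assms(1) by (rule sum_orthonormal_in_V)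
  then show ?thesis
    using assms by (simp add: orthogonal_complement_def subspace_diff subspace_V left.diff
        coefficient_projection)
qed

lemma projection_orthonormal_basis:
  assumes "orthonormal_basis B" "x \<in> V"
  shows "projection B x = x"
proof -
  have B: "orthonormal B" "finite B"
    using assms(1) finite_orthonormal by (auto simp: orthonormal_basis_def)
  then obtain c where "x = (\<Sum>b\<in>B. scale (c b) b)"
    using assms by (auto simp: orthonormal_basis_def span_finite)
  then show ?thesis
    unfolding projection_def using coefficient_sum_orthonormal[OF B] by (auto intro!: sum.cong)
qed

lemma unit_vectors_eq_image_sphere:
  assumes "orthonormal_basis B"
  shows "{u \<in> V. W u u = 1} = (\<lambda>c. \<Sum>b\<in>B. scale (c b) b) ` coordinate_sphere B"
proof -
  have B: "orthonormal B" "finite B"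
    using assms finite_orthonormal by (auto simp: orthonormal_basis_def)
  have "u \<in> (\<lambda>c. \<Sum>b\<in>B. scale (c b) b) ` coordinate_sphere B" if u: "u \<in> V" "W u u = 1" for u
  proof (rule image_eqI)
    let ?c = "\<lambda>b. if b \<in> B then W u b else 0"
    have expansion: "(\<Sum>b\<in>B. scale (W u b) b) = u"
      using projection_orthonormal_basis[OF assms u(1)] by (simp add: projection_def)
    then show "u = (\<Sum>b\<in>B. scale (?c b) b)"
      by simp
    show "?c \<in> coordinate_sphere B"
      using diag_sum_orthonormal[OF B, of "W u"] u(2)
      by (simp add: coordinate_sphere_def expansion del: of_real_sum of_real_power)
  qed
  moreover have "(\<Sum>b\<in>B. scale (c b) b) \<in> {u \<in> V. W u u = 1}" if "c \<in> coordinate_sphere B" for c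
    using that diag_sum_orthonormal[OF B, of c] sum_orthonormal_in_V[OF B(1), of c]
    by (simp add: coordinate_sphere_def del: of_real_sum of_real_power)
  ultimately show ?thesis by blast
qed

lemma card_orthonormal_basis: "orthonormal_basis B \<Longrightarrow> card B = dim V"
  by (intro basis_card_eq_dim) (auto simp: orthonormal_basis_def orthonormal_def independent_orthonormal)

lemma normalized_multiple:
  assumes "v \<in> V" "v \<noteq> 0"
  obtains r :: real where "r > 0" "W (scale (of_real r) v) (scale (of_real r) v) = 1"
proof
  let ?r = "1 / sqrt (Re (W v v))"
  have pos: "0 < Re (W v v)"
    using assms by (rule positive_definite)
  then show "?r > 0" by simp
  have "W (scale (of_real ?r) v) (scale (of_real ?r) v) = of_real (?r\<^sup>2 * Re (W v v))"
    by (simp only: diag_scale norm_of_real power2_abs of_real_mult of_real_Re_diag)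
  also have "?r\<^sup>2 * Re (W v v) = 1"
    using pos by (simp add: power_divide)
  finally show "W (scale (of_real ?r) v) (scale (of_real ?r) v) = 1" by simp
qed

lemma orthonormal_basis_exists_of:
  assumes extend: "\<And>B. orthonormal B \<Longrightarrow> \<forall>b\<in>B. P b \<Longrightarrow> orthogonal_complement B \<noteq> {0} \<Longrightarrow>
    \<exists>v\<in>orthogonal_complement B. W v v = 1 \<and> P v"
  obtains B where "orthonormal_basis B" "\<forall>b\<in>B. P b"
proof -
  define admissible where "admissible B \<longleftrightarrow> orthonormal B \<and> (\<forall>b\<in>B. P b)" for B
  obtain k where "card B \<le> k" if "admissible B" for B
    using orthonormal_bound by (auto simp: admissible_def)
  moreover have "admissible {}"
    by (simp add: admissible_def orthonormal_def)
  ultimately obtain B where B: "admissible B" and maximal: "\<And>A. admissible A \<Longrightarrow> card A \<le> card B"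
    using Lattices_Big.ex_has_greatest_nat[of admissible "{}" card "Suc k"] by (auto simp: less_Suc_eq_le)
  have "orthogonal_complement B = {0}"
  proof (rule ccontr)
    assume "orthogonal_complement B \<noteq> {0}"
    then obtain v where v: "v \<in> orthogonal_complement B" "W v v = 1" "P v"
      using extend B by (auto simp: admissible_def)
    then have "W v b = 0 \<and> W b v = 0" if "b \<in> B" for b
      using that hermitian[of b v] by (auto simp: orthogonal_complement_def)
    then have "v \<notin> B" "admissible (insert v B)"
      using v B by (auto simp: admissible_def orthonormal_def orthogonal_complement_def)
    then show False
      using maximal[of "insert v B"] finite_orthonormal B by (simp add: admissible_def)
  qed
  then have "x = projection B x" if "x \<in> V" for x
    using diff_projection_in_complement[OF _ that, of B] B by (simp add: admissible_def)
  then have "V \<subseteq> span B"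
    using projection_in_span by (metis subsetI)
  then show ?thesis
    using that B by (auto simp: admissible_def orthonormal_basis_def)
qed

lemma orthonormal_basis_exists: obtains B where "orthonormal_basis B"
proof (rule orthonormal_basis_exists_of[of "\<lambda>_. True"])
  fix B assume "orthogonal_complement B \<noteq> {0}"
  then obtain v where v: "v \<in> orthogonal_complement B" "v \<noteq> 0"
    using subspace_0[OF subspace_orthogonal_complement] by blast
  then obtain r :: real where "W (scale (of_real r) v) (scale (of_real r) v) = 1"
    using normalized_multiple[of v] by (auto simp: orthogonal_complement_def)
  then show "\<exists>v\<in>orthogonal_complement B. W v v = 1 \<and> True"
    using subspace_scale[OF subspace_orthogonal_complement v(1)] by blast
qed (use that in blast)

end

section \<open>Hermitian pencils\<close>

locale hermitian_pencil = vector_space scale + W: unitary_space scale W V + Q: hermitian_form scale Q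
  for scale :: "complex \<Rightarrow> 'a::ab_group_add \<Rightarrow> 'a" and Q W V
begin

definition unit_eigenvector :: "'a \<Rightarrow> bool" where
  "unit_eigenvector v \<longleftrightarrow> v \<in> V \<and> W v v = 1 \<and> (\<forall>x\<in>V. Q v x = Q v v * W v x)"

definition eigenbasis :: "'a set \<Rightarrow> bool" where
  "eigenbasis B \<longleftrightarrow> W.orthonormal_basis B \<and> (\<forall>b\<in>B. unit_eigenvector b)"

definition eigenspace :: "complex \<Rightarrow> 'a set" where
  "eigenspace l = {v \<in> V. \<forall>x\<in>V. Q v x = l * W v x}"

definition spectrum :: "complex set" where
  "spectrum = {l. eigenspace l \<noteq> {0}}"

lemma rayleigh_minimum:
  assumes "V \<noteq> {0}"
  obtains v where "v \<in> V" "W v v = 1" "\<And>u. u \<in> V \<Longrightarrow> W u u = 1 \<Longrightarrow> Re (Q v v) \<le> Re (Q u u)"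
proof -
  obtain B where B: "W.orthonormal_basis B"
    by (rule W.orthonormal_basis_exists)
  then have "finite B"
    by (simp add: W.orthonormal_basis_def W.finite_orthonormal)
  let ?comb = "\<lambda>c. \<Sum>b\<in>B. scale (c b) b"
  obtain u where u: "u \<in> V" "u \<noteq> 0"
    using assms subspace_0[OF W.subspace_V] by blast
  then obtain r where "W (scale (of_real r) u) (scale (of_real r) u) = 1"
    by (rule W.normalized_multiple)
  then have "{u \<in> V. W u u = 1} \<noteq> {}"
    using subspace_scale[OF W.subspace_V u(1)] by blast
  then have "coordinate_sphere B \<noteq> ({} :: ('a \<Rightarrow> complex) set)"
    unfolding W.unit_vectors_eq_image_sphere[OF B] by simp
  moreover have "continuous_on (coordinate_sphere B) (\<lambda>c. Re (Q (?comb c) (?comb c)))"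
    unfolding Q.left.sum Q.sum_right Q.scale_left Q.scale_right by (intro continuous_intros)
  ultimately obtain c where "c \<in> coordinate_sphere B"
    and "\<forall>c'\<in>coordinate_sphere B. Re (Q (?comb c) (?comb c)) \<le> Re (Q (?comb c') (?comb c'))"
    using continuous_attains_inf[OF compact_coordinate_sphere[OF \<open>finite B\<close>]] by blast
  then have "?comb c \<in> {u \<in> V. W u u = 1}"
    and "\<forall>u\<in>{u \<in> V. W u u = 1}. Re (Q (?comb c) (?comb c)) \<le> Re (Q u u)"
    unfolding W.unit_vectors_eq_image_sphere[OF B] by blast+
  then show ?thesis
    using that by blast
qed

lemma unit_eigenvector_exists:
  assumes "V \<noteq> {0}"
  obtains v where "unit_eigenvector v"
proof -
  obtain v where v: "v \<in> V" "W v v = 1"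
    and minimal: "\<And>u. u \<in> V \<Longrightarrow> W u u = 1 \<Longrightarrow> Re (Q v v) \<le> Re (Q u u)"
    using rayleigh_minimum[OF assms] by blast
  define H where "H x y = Q x y + of_real (- Re (Q v v)) * W x y" for x y
  interpret H: hermitian_form scale H
    unfolding H_def
    by (intro hermitian_form_add hermitian_form_scaled Q.hermitian_form_axioms W.hermitian_form_axioms)
  have nonneg: "0 \<le> Re (H u u)" if "u \<in> V" for u
  proof (cases "u = 0")
    case False
    then obtain r :: real where r: "r > 0" "W (scale (of_real r) u) (scale (of_real r) u) = 1"
      using W.normalized_multiple \<open>u \<in> V\<close> by blast
    then have "0 \<le> Re (H (scale (of_real r) u) (scale (of_real r) u))"
      using minimal subspace_scale[OF W.subspace_V \<open>u \<in> V\<close>] by (simp add: H_def)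
    then show ?thesis
      using r(1) by (simp add: H.diag_scale zero_le_mult_iff)
  qed simp
  have H_v: "H v x = Q v x - Q v v * W v x" for x
    by (simp add: H_def Q.of_real_Re_diag)
  then have "H v v = 0"
    using v(2) by simp
  then have "H v x = 0" if "x \<in> V" for x
    using H.nonneg_on_line_null_orthogonal[of v x] nonneg that v(1)
    by (simp add: subspace_add subspace_scale W.subspace_V)
  then have "unit_eigenvector v"
    using v unfolding unit_eigenvector_def H_v right_minus_eq by blast
  then show ?thesis by (rule that)
qed

lemma hermitian_pencil_subspace:
  assumes "subspace U" "U \<subseteq> V"
  shows "hermitian_pencil scale Q W U"
proof
  show "\<exists>T. finite T \<and> U \<subseteq> span T"
    using W.finite_spanning_set assms(2) by blast
qed (use assms W.positive_definite in auto)

lemma unit_eigenvector_of_complement: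
  assumes "W.orthonormal B" "\<forall>b\<in>B. unit_eigenvector b"
    and v: "v \<in> W.orthogonal_complement B" "W v v = 1"
    and eigen: "\<forall>x\<in>W.orthogonal_complement B. Q v x = Q v v * W v x"
  shows "unit_eigenvector v"
proof -
  have "v \<in> V"
    using v(1) by (simp add: W.orthogonal_complement_def)
  have "Q v x = Q v v * W v x" if "x \<in> V" for x
  proof -
    have "W v b = 0 \<and> Q v b = 0" if "b \<in> B" for b
    proof -
      have "W v b = 0"
        using v(1) that by (simp add: W.orthogonal_complement_def)
      moreover have "Q b v = Q b b * W b v"
        using assms(2) that \<open>v \<in> V\<close> unfolding unit_eigenvector_def by blast
      ultimately show ?thesis
        using Q.hermitian[of v b] W.hermitian[of b v] by simp
    qed
    then have "W v (W.projection B x) = 0" "Q v (W.projection B x) = 0"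
      by (simp_all add: W.projection_def W.sum_right Q.sum_right W.scale_right Q.scale_right)
    moreover have "Q v (x - W.projection B x) = Q v v * W v (x - W.projection B x)"
      using eigen W.diff_projection_in_complement[OF assms(1) that] by blast
    ultimately show ?thesis
      using Q.add_right[of v "x - W.projection B x" "W.projection B x"]
        W.add_right[of v "x - W.projection B x" "W.projection B x"] by simp
  qed
  then show ?thesis
    using v \<open>v \<in> V\<close> unfolding unit_eigenvector_def by blast
qed

lemma eigenbasis_exists: obtains B where "eigenbasis B"
proof (rule W.orthonormal_basis_exists_of[of unit_eigenvector])
  fix B assume B: "W.orthonormal B" "\<forall>b\<in>B. unit_eigenvector b" "W.orthogonal_complement B \<noteq> {0}"
  interpret C: hermitian_pencil scale Q W "W.orthogonal_complement B"
    by (rule hermitian_pencil_subspace[OF W.subspace_orthogonal_complement])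
      (simp add: W.orthogonal_complement_def)
  obtain v where "C.unit_eigenvector v"
    using B(3) by (rule C.unit_eigenvector_exists)
  then show "\<exists>v\<in>W.orthogonal_complement B. W v v = 1 \<and> unit_eigenvector v"
    using unit_eigenvector_of_complement[OF B(1,2)] by (auto simp: C.unit_eigenvector_def)
qed (use that in \<open>auto simp: eigenbasis_def\<close>)

lemma eigenbasisD:
  assumes "eigenbasis B"
  shows "W.orthonormal B" "finite B" "B \<subseteq> V"
    and "b \<in> B \<Longrightarrow> x \<in> V \<Longrightarrow> Q b x = Q b b * W b x"
  using assms W.finite_orthonormal
  unfolding eigenbasis_def W.orthonormal_basis_def W.orthonormal_def unit_eigenvector_def by blast+

lemma subspace_eigenspace: "subspace (eigenspace l)"
  using W.subspace_V by (simp add: subspace_def eigenspace_def distrib_left mult.left_commute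
      Q.add_left W.add_left Q.scale_left W.scale_left)

lemma eigenspace_eq_span:
  assumes B: "eigenbasis B"
  shows "eigenspace l = span {b \<in> B. Q b b = l}"
proof (intro equalityI subsetI)
  fix v assume v: "v \<in> eigenspace l"
  then have "v \<in> V" by (simp add: eigenspace_def)
  have "scale (W v b) b \<in> span {b \<in> B. Q b b = l}" if b: "b \<in> B" for b
  proof (cases "Q b b = l")
    case False
    have "l * W v b = Q v b"
      using v b eigenbasisD(3)[OF B] by (auto simp: eigenspace_def)
    also have "\<dots> = cnj (Q b b * W b v)"
      using eigenbasisD(4)[OF B b \<open>v \<in> V\<close>] Q.hermitian[of v b] by simp
    also have "\<dots> = Q b b * W v b"
      by (simp flip: Q.hermitian W.hermitian)
    finally show ?thesis
      using False by (simp add: span_zero)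
  qed (use b in \<open>auto intro: span_scale span_base\<close>)
  then have "W.projection B v \<in> span {b \<in> B. Q b b = l}"
    unfolding W.projection_def by (rule span_sum)
  then show "v \<in> span {b \<in> B. Q b b = l}"
    using B W.projection_orthonormal_basis \<open>v \<in> V\<close> by (simp add: eigenbasis_def)
next
  have "{b \<in> B. Q b b = l} \<subseteq> eigenspace l"
    using eigenbasisD[OF B] unfolding eigenspace_def by blast
  then show "v \<in> eigenspace l" if "v \<in> span {b \<in> B. Q b b = l}" for v
    using that span_minimal[OF _ subspace_eigenspace] by blast
qed

lemma dim_eigenspace: "eigenbasis B \<Longrightarrow> dim (eigenspace l) = card {b \<in> B. Q b b = l}"
  unfolding eigenspace_eq_span
  by (intro dim_span_eq_card_independent W.independent_orthonormal
      W.orthonormal_subset[OF eigenbasisD(1)]) auto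

lemma spectrum_eq_image:
  assumes B: "eigenbasis B"
  shows "spectrum = (\<lambda>b. Q b b) ` B"
proof -
  have "0 \<notin> B"
    using W.independent_orthonormal[OF eigenbasisD(1)[OF B]] dependent_zero by blast
  have "l \<in> spectrum \<longleftrightarrow> l \<in> (\<lambda>b. Q b b) ` B" for l
  proof
    assume "l \<in> (\<lambda>b. Q b b) ` B"
    then obtain b where "b \<in> B" "Q b b = l" by blast
    then have "b \<in> eigenspace l" "b \<noteq> 0"
      using \<open>0 \<notin> B\<close> by (auto simp: eigenspace_eq_span[OF B] intro: span_base)
    then show "l \<in> spectrum"
      by (auto simp: spectrum_def)
  next
    assume "l \<in> spectrum"
    then have "{b \<in> B. Q b b = l} \<noteq> {}"
      unfolding spectrum_def eigenspace_eq_span[OF B] using span_empty by force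
    then show "l \<in> (\<lambda>b. Q b b) ` B" by auto
  qed
  then show ?thesis by blast
qed

lemma finite_spectrum: "finite spectrum"
  by (metis eigenbasis_exists eigenbasisD(2) finite_imageI spectrum_eq_image)

lemma spectrum_real:
  assumes "l \<in> spectrum"
  shows "l \<in> \<real>"
proof -
  obtain B where B: "eigenbasis B" by (rule eigenbasis_exists)
  then obtain b where "l = Q b b"
    using assms by (auto simp: spectrum_eq_image)
  then show ?thesis
    using Q.hermitian[of b b, symmetric] by (simp add: Reals_cnj_iff)
qed

lemma sum_dim_eigenspaces:
  assumes B: "eigenbasis B"
  shows "(\<Sum>l\<in>{l \<in> spectrum. P l}. dim (eigenspace l)) = card {b \<in> B. P (Q b b)}"
proof -
  have "(\<Sum>l\<in>{l \<in> spectrum. P l}. dim (eigenspace l)) =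
      (\<Sum>l\<in>{l \<in> spectrum. P l}. \<Sum>b\<in>{b \<in> {b \<in> B. P (Q b b)}. Q b b = l}. 1)"
    unfolding dim_eigenspace[OF B] by (intro sum.cong) (auto intro!: arg_cong[where f = card])
  also have "\<dots> = card {b \<in> B. P (Q b b)}"
    using eigenbasisD(2)[OF B] finite_spectrum
    by (subst sum.group) (auto simp: spectrum_eq_image[OF B])
  finally show ?thesis .
qed

lemma sum_dim_spectrum: "(\<Sum>l\<in>spectrum. dim (eigenspace l)) = dim V"
proof -
  obtain B where B: "eigenbasis B" by (rule eigenbasis_exists)
  then show ?thesis
    using sum_dim_eigenspaces[OF B, of "\<lambda>_. True"] W.card_orthonormal_basis
    by (simp add: eigenbasis_def)
qed

lemma diag_expansion:
  assumes B: "eigenbasis B" and "v \<in> V"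
  shows "Re (Q v v) - x * Re (W v v) = (\<Sum>b\<in>B. (Re (Q b b) - x) * (cmod (W v b))\<^sup>2)"
proof -
  have expansion: "(\<Sum>b\<in>B. scale (W v b) b) = v"
    using B W.projection_orthonormal_basis \<open>v \<in> V\<close> by (simp add: eigenbasis_def W.projection_def)
  have "Q v v = (\<Sum>b\<in>B. W v b * Q b v)"
    by (subst (1) expansion[symmetric]) (simp only: Q.left.sum Q.left.scale)
  also have "\<dots> = (\<Sum>b\<in>B. of_real (Re (Q b b) * (cmod (W v b))\<^sup>2))"
  proof (rule sum.cong[OF refl])
    fix b assume "b \<in> B"
    then have "W v b * Q b v = Q b b * (W v b * cnj (W v b))"
      using eigenbasisD(4)[OF B _ \<open>v \<in> V\<close>] W.hermitian[of b v] by simp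
    then show "W v b * Q b v = of_real (Re (Q b b) * (cmod (W v b))\<^sup>2)"
      by (simp only: of_real_mult Q.of_real_Re_diag complex_norm_square)
  qed
  finally have "Re (Q v v) = (\<Sum>b\<in>B. Re (Q b b) * (cmod (W v b))\<^sup>2)"
    by simp
  moreover have "Re (W v v) = (\<Sum>b\<in>B. (cmod (W v b))\<^sup>2)"
    using W.diag_sum_orthonormal[OF eigenbasisD(1,2)[OF B], of "W v"] by (simp add: expansion)
  ultimately show ?thesis
    by (simp add: left_diff_distrib sum_subtractf sum_distrib_left)
qed

lemma dim_le_card_low_eigenvectors:
  assumes B: "eigenbasis B"
    and S: "subspace S" "S \<subseteq> V" "\<And>v. v \<in> S \<Longrightarrow> Re (Q v v) \<le> x * Re (W v v)"
  shows "dim S \<le> card {b \<in> B. Re (Q b b) \<le> x}"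
proof -
  let ?low = "{b \<in> B. Re (Q b b) \<le> x}"
  have low: "W.orthonormal ?low"
    by (rule W.orthonormal_subset[OF eigenbasisD(1)[OF B]]) auto
  interpret projection: Vector_Spaces.linear scale scale "W.projection ?low"
    by (rule W.linear_projection)
  have "v = 0" if v: "v \<in> S" "W.projection ?low v = 0" for v
  proof -
    have "v \<in> V" using v(1) S(2) by blast
    have low_zero: "W v b = 0" if "b \<in> ?low" for b
      using W.coefficient_projection[OF low that, of v] v(2) by simp
    have nonneg: "0 \<le> (Re (Q b b) - x) * (cmod (W v b))\<^sup>2" if "b \<in> B" for b
      using low_zero[of b] that by (cases "Re (Q b b) \<le> x") auto
    have "(\<Sum>b\<in>B. (Re (Q b b) - x) * (cmod (W v b))\<^sup>2) \<le> 0"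
      using S(3)[OF v(1)] by (simp flip: diag_expansion[OF B \<open>v \<in> V\<close>])
    then have "(\<Sum>b\<in>B. (Re (Q b b) - x) * (cmod (W v b))\<^sup>2) = 0"
      by (intro order_antisym sum_nonneg nonneg)
    then have "\<forall>b\<in>B. (Re (Q b b) - x) * (cmod (W v b))\<^sup>2 = 0"
      by (subst (asm) sum_nonneg_eq_0_iff[OF eigenbasisD(2)[OF B] nonneg])
    then have "W v b = 0" if "b \<in> B" for b
      using low_zero[of b] that by (cases "Re (Q b b) \<le> x") auto
    then have "W.projection B v = 0"
      by (simp add: W.projection_def)
    then show ?thesis
      using B W.projection_orthonormal_basis \<open>v \<in> V\<close> by (simp add: eigenbasis_def)
  qed
  then have "inj_on (W.projection ?low) S"
    by (simp add: projection.inj_on_iff_eq_0[OF S(1)])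
  then have "dim S = dim (W.projection ?low ` S)"
    by (rule projection.dim_inj_image[OF S(1), symmetric])
  also have "\<dots> \<le> card ?low"
    using eigenbasisD(2)[OF B] W.projection_in_span by (intro dim_le_card) auto
  finally show ?thesis .
qed

lemma span_low_eigenvectors:
  assumes B: "eigenbasis B" and v: "v \<in> span {b \<in> B. Re (Q b b) \<le> x}"
  shows "v \<in> V" "Re (Q v v) \<le> x * Re (W v v)"
proof -
  let ?low = "{b \<in> B. Re (Q b b) \<le> x}"
  show "v \<in> V"
    using v span_minimal[OF _ W.subspace_V, of ?low] eigenbasisD(3)[OF B] by blast
  obtain c where c: "v = (\<Sum>a\<in>?low. scale (c a) a)"
    using v eigenbasisD(2)[OF B] by (auto simp: span_finite)
  have "W v b = 0" if "b \<in> B - ?low" for b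
    using that eigenbasisD(1)[OF B]
    by (auto simp: c W.left.sum W.left.scale W.orthonormal_def intro!: sum.neutral)
  then have "(Re (Q b b) - x) * (cmod (W v b))\<^sup>2 \<le> 0" if "b \<in> B" for b
    using that by (cases "b \<in> ?low") (auto simp: mult_le_0_iff)
  then have "(\<Sum>b\<in>B. (Re (Q b b) - x) * (cmod (W v b))\<^sup>2) \<le> 0"
    by (rule sum_nonpos)
  then show "Re (Q v v) \<le> x * Re (W v v)"
    by (simp flip: diag_expansion[OF B \<open>v \<in> V\<close>])
qed

lemma courant_fischer:
  "n < (\<Sum>l\<in>{l \<in> spectrum. Re l \<le> x}. dim (eigenspace l)) \<longleftrightarrow>
    (\<exists>S. subspace S \<and> S \<subseteq> V \<and> n < dim S \<and> (\<forall>v\<in>S. Re (Q v v) \<le> x * Re (W v v)))"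
proof -
  obtain B where B: "eigenbasis B" by (rule eigenbasis_exists)
  let ?low = "{b \<in> B. Re (Q b b) \<le> x}"
  have "dim (span ?low) = card ?low"
    by (intro dim_span_eq_card_independent W.independent_orthonormal
        W.orthonormal_subset[OF eigenbasisD(1)[OF B]]) auto
  then have "\<exists>S. subspace S \<and> S \<subseteq> V \<and> n < dim S \<and> (\<forall>v\<in>S. Re (Q v v) \<le> x * Re (W v v))"
    if "n < card ?low"
    using that span_low_eigenvectors[OF B] by (intro exI[of _ "span ?low"]) auto
  moreover have "n < card ?low"
    if "subspace S" "S \<subseteq> V" "n < dim S" "\<forall>v\<in>S. Re (Q v v) \<le> x * Re (W v v)" for S
    using that dim_le_card_low_eigenvectors[OF B, of S x] by fastforce
  ultimately show ?thesis
    unfolding sum_dim_eigenspaces[OF B] by blast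
qed

end

lemma Min_cumulative_le_iff:
  fixes E :: "'a::linorder set" and m :: "'a \<Rightarrow> nat"
  assumes "finite E" "n < sum m E"
  shows "Min {y \<in> E. n < sum m {\<mu> \<in> E. \<mu> \<le> y}} \<le> x \<longleftrightarrow> n < sum m {\<mu> \<in> E. \<mu> \<le> x}"
proof -
  let ?Y = "{y \<in> E. n < sum m {\<mu> \<in> E. \<mu> \<le> y}}"
  have attained: "\<exists>y\<in>?Y. y \<le> x" if n: "n < sum m {\<mu> \<in> E. \<mu> \<le> x}" for x
  proof
    let ?y = "Max {\<mu> \<in> E. \<mu> \<le> x}"
    have "{\<mu> \<in> E. \<mu> \<le> x} \<noteq> {}"
      using n by (metis not_less_zero sum.empty)
    then have y: "?y \<in> {\<mu> \<in> E. \<mu> \<le> x}"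
      using assms(1) by (intro Max_in) auto
    then show "?y \<le> x" by simp
    have "{\<mu> \<in> E. \<mu> \<le> ?y} = {\<mu> \<in> E. \<mu> \<le> x}"
      using y assms(1) by (auto intro: order_trans)
    then show "?y \<in> ?Y"
      using n y by simp
  qed
  have "{\<mu> \<in> E. \<mu> \<le> Max E} = E"
    using assms(1) by auto
  then have "?Y \<noteq> {}"
    using attained[of "Max E"] assms(2) by auto
  then have "Min ?Y \<le> x \<longleftrightarrow> (\<exists>y\<in>?Y. y \<le> x)"
    using assms(1) by (simp add: Min_le_iff)
  also have "\<dots> \<longleftrightarrow> n < sum m {\<mu> \<in> E. \<mu> \<le> x}"
  proof
    assume "\<exists>y\<in>?Y. y \<le> x"
    then obtain y where "n < sum m {\<mu> \<in> E. \<mu> \<le> y}" "y \<le> x" by blast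
    moreover from this have "sum m {\<mu> \<in> E. \<mu> \<le> y} \<le> sum m {\<mu> \<in> E. \<mu> \<le> x}"
      using assms(1) by (intro sum_mono2) auto
    ultimately show "n < sum m {\<mu> \<in> E. \<mu> \<le> x}" by simp
  qed (rule attained)
  finally show ?thesis .
qed

section \<open>The quadratic form of the Sturm--Liouville problem\<close>

abbreviation (input) seq_scale :: "complex \<Rightarrow> (nat \<Rightarrow> complex) \<Rightarrow> nat \<Rightarrow> complex" where
  "seq_scale c y \<equiv> \<lambda>n. c * y n"

interpretation seq: vector_space seq_scale
  by unfold_locales (auto simp: fun_eq_iff algebra_simps)

definition weighted_form :: "(nat \<Rightarrow> real) \<Rightarrow> nat \<Rightarrow> (nat \<Rightarrow> complex) \<Rightarrow> (nat \<Rightarrow> complex) \<Rightarrow> complex" where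
  "weighted_form w N y v = (\<Sum>n=1..N. of_real (w n) * (y n * cnj (v n)))"

definition dirichlet_form :: "(nat \<Rightarrow> real) \<Rightarrow> nat \<Rightarrow> (nat \<Rightarrow> complex) \<Rightarrow> (nat \<Rightarrow> complex) \<Rightarrow> complex" where
  "dirichlet_form f N y v = (\<Sum>n=1..<N. of_real (f n) * ((y (n+1) - y n) * cnj (v (n+1) - v n)))"

definition coupling :: "nat \<Rightarrow> complex \<Rightarrow> (nat \<Rightarrow> complex) \<Rightarrow> complex" where
  "coupling N z y = y 1 + cnj z * y N"

text \<open>The strengths \<open>c\<close> and \<open>b\<close> range over \<open>(-\<infinity>, \<infinity>]\<close>. An infinite strength forces the term it multiplies
  to vanish on the form domain, so the value \<open>real_of_ereal \<infinity> = 0\<close> is harmless.\<close>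

definition sl_form :: "(nat \<Rightarrow> real) \<Rightarrow> (nat \<Rightarrow> real) \<Rightarrow> nat \<Rightarrow> complex \<Rightarrow> ereal \<Rightarrow> ereal
    \<Rightarrow> (nat \<Rightarrow> complex) \<Rightarrow> (nat \<Rightarrow> complex) \<Rightarrow> complex" where
  "sl_form f q N z c b y v = dirichlet_form f N y v + weighted_form q N y v
     + of_real (real_of_ereal c) * (coupling N z y * cnj (coupling N z v))
     + of_real (real_of_ereal b) * (y N * cnj (v N))"

definition form_domain :: "nat \<Rightarrow> complex \<Rightarrow> ereal \<Rightarrow> ereal \<Rightarrow> (nat \<Rightarrow> complex) set" where
  "form_domain N z c b = {y. (\<forall>n. n \<notin> {1..N} \<longrightarrow> y n = 0) \<and>
     (c = \<infinity> \<longrightarrow> coupling N z y = 0) \<and> (b = \<infinity> \<longrightarrow> y N = 0)}"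

definition unit_seq :: "nat \<Rightarrow> nat \<Rightarrow> complex" where
  "unit_seq k = (\<lambda>n. of_bool (n = k))"

lemma linear_coordinate: "Vector_Spaces.linear seq_scale (*) (\<lambda>y. y k)"
  by unfold_locales simp_all

lemma linear_difference: "Vector_Spaces.linear seq_scale (*) (\<lambda>y. y (k+1) - y k)"
  by unfold_locales (simp_all add: algebra_simps)

lemma linear_coupling: "Vector_Spaces.linear seq_scale (*) (coupling N z)"
  by unfold_locales (simp_all add: coupling_def algebra_simps)

lemma hermitian_form_weighted_form: "hermitian_form seq_scale (weighted_form w N)"
  unfolding weighted_form_def[abs_def]
  by (intro hermitian_form_sum hermitian_form_scaled hermitian_form_rank_one linear_coordinate
      seq.vector_space_axioms)

lemma hermitian_form_dirichlet_form: "hermitian_form seq_scale (dirichlet_form f N)"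
  unfolding dirichlet_form_def[abs_def]
  by (intro hermitian_form_sum hermitian_form_scaled linear_difference seq.vector_space_axioms
      hermitian_form_rank_one[of _ "\<lambda>y. y (n+1) - y n" for n])

lemma hermitian_form_sl_form: "hermitian_form seq_scale (sl_form f q N z c b)"
  unfolding sl_form_def[abs_def]
  by (intro hermitian_form_add hermitian_form_dirichlet_form hermitian_form_weighted_form
      hermitian_form_scaled hermitian_form_rank_one linear_coupling linear_coordinate)

lemma weighted_form_diag: "Re (weighted_form w N v v) = (\<Sum>n=1..N. w n * (cmod (v n))\<^sup>2)"
  by (simp add: weighted_form_def complex_mult_cnj cmod_power2)

lemma sl_form_diag:
  "Re (sl_form f q N z c b v v) = Re (dirichlet_form f N v v) + Re (weighted_form q N v v)
     + real_of_ereal c * (cmod (coupling N z v))\<^sup>2 + real_of_ereal b * (cmod (v N))\<^sup>2"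
  by (simp add: sl_form_def complex_mult_cnj cmod_power2)

lemma subspace_form_domain: "seq.subspace (form_domain N z c b)"
proof -
  interpret coupling: Vector_Spaces.linear seq_scale "(*)" "coupling N z"
    by (rule linear_coupling)
  show ?thesis
    by (simp add: seq.subspace_def form_domain_def coupling.add coupling.scale)
qed

lemma form_domain_subset_span: "form_domain N z c b \<subseteq> seq.span (unit_seq ` {1..N})"
proof
  fix y assume y: "y \<in> form_domain N z c b"
  have "(\<Sum>k\<in>{1..N}. seq_scale (y k) (unit_seq k)) n = (\<Sum>k\<in>{1..N}. y k * unit_seq k n)" for n
    by (induction N) simp_all
  moreover have "(\<Sum>k\<in>{1..N}. y k * unit_seq k n) = y n" for n
    using y by (cases "n \<in> {1..N}") (simp_all add: form_domain_def unit_seq_def)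
  ultimately have "(\<Sum>k\<in>{1..N}. seq_scale (y k) (unit_seq k)) = y"
    by (simp add: fun_eq_iff)
  moreover have "(\<Sum>k\<in>{1..N}. seq_scale (y k) (unit_seq k)) \<in> seq.span (unit_seq ` {1..N})"
    by (intro seq.span_sum seq.span_scale seq.span_base) auto
  ultimately show "y \<in> seq.span (unit_seq ` {1..N})" by simp
qed

lemma dim_form_domain_hyperplane:
  assumes "Vector_Spaces.linear seq_scale (*) l" "v \<in> form_domain N z c b" "l v \<noteq> 0"
  shows "seq.dim (form_domain N z c b) = seq.dim {y \<in> form_domain N z c b. l y = 0} + 1"
  using seq.dim_hyperplane[OF assms(1) subspace_form_domain form_domain_subset_span] assms(2,3) by auto

lemma dim_sequences_supported_upto: "seq.dim (form_domain k z 0 0) = k"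
proof (induction k)
  case 0
  have "form_domain 0 z 0 0 \<subseteq> seq.span {}"
    by (auto simp: form_domain_def fun_eq_iff)
  then show ?case
    using seq.dim_le_card[of _ "{}"] by fastforce
next
  case (Suc k)
  have "unit_seq (Suc k) \<in> form_domain (Suc k) z 0 0" "unit_seq (Suc k) (Suc k) \<noteq> 0"
    by (auto simp: form_domain_def unit_seq_def)
  moreover have "{y \<in> form_domain (Suc k) z 0 0. y (Suc k) = 0} = form_domain k z 0 0"
    by (auto simp: form_domain_def) (metis le_SucE)
  ultimately show ?case
    using dim_form_domain_hyperplane[OF linear_coordinate] Suc.IH by simp
qed

lemma dim_form_domain:
  assumes "2 \<le> N"
  shows "seq.dim (form_domain N z c b) = N - of_bool (c = \<infinity>) - of_bool (b = \<infinity>)"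
proof -
  have "unit_seq N \<in> form_domain N z 0 0" "unit_seq N N \<noteq> 0"
    using assms by (auto simp: form_domain_def unit_seq_def)
  then have "seq.dim (form_domain N z 0 0) = seq.dim {y \<in> form_domain N z 0 0. y N = 0} + 1"
    by (rule dim_form_domain_hyperplane[OF linear_coordinate])
  moreover have "form_domain N z 0 b =
      (if b = \<infinity> then {y \<in> form_domain N z 0 0. y N = 0} else form_domain N z 0 0)"
    by (auto simp: form_domain_def)
  ultimately have dim_b: "seq.dim (form_domain N z 0 b) = N - of_bool (b = \<infinity>)"
    using dim_sequences_supported_upto[of N z] by auto
  have "unit_seq 1 \<in> form_domain N z 0 b" "coupling N z (unit_seq 1) \<noteq> 0"
    using assms by (auto simp: form_domain_def unit_seq_def coupling_def)
  then have "seq.dim (form_domain N z 0 b) = seq.dim {y \<in> form_domain N z 0 b. coupling N z y = 0} + 1"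
    by (rule dim_form_domain_hyperplane[OF linear_coupling])
  moreover have "form_domain N z c b =
      (if c = \<infinity> then {y \<in> form_domain N z 0 b. coupling N z y = 0} else form_domain N z 0 b)"
    by (auto simp: form_domain_def)
  ultimately show ?thesis
    using dim_b by auto
qed

lemma hermitian_pencil_sl_form:
  assumes "\<And>n. n \<in> {1..N} \<Longrightarrow> 0 < w n"
  shows "hermitian_pencil seq_scale (sl_form f q N z c b) (weighted_form w N) (form_domain N z c b)"
proof -
  interpret W: hermitian_form seq_scale "weighted_form w N"
    by (rule hermitian_form_weighted_form)
  interpret Q: hermitian_form seq_scale "sl_form f q N z c b"
    by (rule hermitian_form_sl_form)
  show ?thesis
  proof
    show "\<exists>T. finite T \<and> form_domain N z c b \<subseteq> seq.span T"
      using form_domain_subset_span by blast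
    fix v assume "v \<in> form_domain N z c b" "v \<noteq> 0"
    then obtain n where n: "n \<in> {1..N}" "v n \<noteq> 0"
      by (auto simp: form_domain_def fun_eq_iff)
    have "0 < w n * (cmod (v n))\<^sup>2"
      using n assms by simp
    also have "\<dots> \<le> (\<Sum>n=1..N. w n * (cmod (v n))\<^sup>2)"
      using n assms by (intro member_le_sum) (auto simp: less_imp_le)
    finally show "0 < Re (weighted_form w N v v)"
      by (simp add: weighted_form_diag)
  qed (rule subspace_form_domain)
qed

section \<open>Boundary value problems as Hermitian pencils\<close>

definition flux :: "(nat \<Rightarrow> real) \<Rightarrow> (nat \<Rightarrow> complex) \<Rightarrow> nat \<Rightarrow> complex" where
  "flux f y n = of_real (f n) * (y (n+1) - y n)"

definition residual :: "(nat \<Rightarrow> real) \<Rightarrow> (nat \<Rightarrow> real) \<Rightarrow> (nat \<Rightarrow> real) \<Rightarrow> complex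
    \<Rightarrow> (nat \<Rightarrow> complex) \<Rightarrow> nat \<Rightarrow> complex" where
  "residual f q w l y n =
     - (flux f y n - flux f y (n-1)) + (of_real (q n) - l * of_real (w n)) * y n"

definition left_defect :: "(nat \<Rightarrow> real) \<Rightarrow> nat \<Rightarrow> complex \<Rightarrow> ereal \<Rightarrow> (nat \<Rightarrow> complex) \<Rightarrow> complex" where
  "left_defect f N z c y = flux f y 0 - of_real (real_of_ereal c) * coupling N z y"

definition right_defect :: "(nat \<Rightarrow> real) \<Rightarrow> nat \<Rightarrow> complex \<Rightarrow> ereal \<Rightarrow> (nat \<Rightarrow> complex) \<Rightarrow> complex" where
  "right_defect f N z b y = flux f y N + z * flux f y 0 + of_real (real_of_ereal b) * y N"

definition coupled_bc :: "(nat \<Rightarrow> real) \<Rightarrow> nat \<Rightarrow> complex \<Rightarrow> ereal \<Rightarrow> ereal \<Rightarrow> (nat \<Rightarrow> complex) \<Rightarrow> bool" where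
  "coupled_bc f N z c b y \<longleftrightarrow>
     (if c = \<infinity> then coupling N z y = 0 else left_defect f N z c y = 0) \<and>
     (if b = \<infinity> then y N = 0 else right_defect f N z b y = 0)"

lemma sl_eq_iff_residual: "sl_eq f q w N l y \<longleftrightarrow> (\<forall>n\<in>{1..N}. residual f q w l y n = 0)"
proof -
  have "residual f q w l y n =
      - (of_real (f n) * (y (n+1) - y n) - of_real (f (n-1)) * (y n - y (n-1))) + of_real (q n) * y n
      - l * of_real (w n) * y n" if "n \<in> {1..N}" for n
    using that by (simp add: residual_def flux_def algebra_simps)
  then show ?thesis
    unfolding sl_eq_def by (intro ball_cong refl) (simp only: right_minus_eq)
qed

lemma summation_by_parts:
  fixes g v :: "nat \<Rightarrow> 'a::comm_ring_1"
  assumes "1 \<le> N"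
  shows "(\<Sum>n=1..N. - (g n - g (n-1)) * v n) =
    (\<Sum>n=1..<N. g n * (v (n+1) - v n)) + g 0 * v 1 - g N * v N"
  using assms by (induction N rule: dec_induct) (simp_all add: algebra_simps)

lemma green_identity:
  assumes "1 \<le> N"
  shows "(\<Sum>n=1..N. residual f q w l y n * cnj (v n)) =
    sl_form f q N z c b y v - l * weighted_form w N y v
    + left_defect f N z c y * cnj (coupling N z v) - right_defect f N z b y * cnj (v N)"
proof -
  have "(\<Sum>n=1..N. residual f q w l y n * cnj (v n)) =
      (\<Sum>n=1..N. - (flux f y n - flux f y (n-1)) * cnj (v n)
         + (of_real (q n) * (y n * cnj (v n)) - l * (of_real (w n) * (y n * cnj (v n)))))"
    by (intro sum.cong) (auto simp: residual_def algebra_simps)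
  also have "\<dots> = (\<Sum>n=1..N. - (flux f y n - flux f y (n-1)) * cnj (v n))
      + (weighted_form q N y v - l * weighted_form w N y v)"
    by (simp only: sum.distrib sum_subtractf weighted_form_def sum_distrib_left)
  also have "(\<Sum>n=1..N. - (flux f y n - flux f y (n-1)) * cnj (v n)) =
      dirichlet_form f N y v + flux f y 0 * cnj (v 1) - flux f y N * cnj (v N)"
    using summation_by_parts[OF assms, of "flux f y" "\<lambda>n. cnj (v n)"]
    by (simp add: dirichlet_form_def flux_def mult.assoc)
  finally show ?thesis
    by (simp add: sl_form_def left_defect_def right_defect_def coupling_def algebra_simps)
qed

lemma sl_form_cong:
  assumes "2 \<le> N" "\<And>n. n \<in> {1..N} \<Longrightarrow> x n = y n"
  shows "sl_form f q N z c b x v = sl_form f q N z c b y v"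
proof -
  have "dirichlet_form f N x v = dirichlet_form f N y v" "weighted_form q N x v = weighted_form q N y v"
    unfolding dirichlet_form_def weighted_form_def using assms(2) by (auto intro!: sum.cong)
  moreover have "x 1 = y 1" "x N = y N"
    using assms by auto
  ultimately show ?thesis
    by (simp add: sl_form_def coupling_def)
qed

lemma weighted_form_cong:
  "(\<And>n. n \<in> {1..N} \<Longrightarrow> x n = y n) \<Longrightarrow> weighted_form w N x v = weighted_form w N y v"
  unfolding weighted_form_def by (auto intro!: sum.cong)

locale sl_equation =
  fixes f q w :: "nat \<Rightarrow> real" and N :: nat
  assumes N_ge_2: "2 \<le> N"
    and f_nonzero: "n \<le> N \<Longrightarrow> f n \<noteq> 0"
    and w_pos: "n \<in> {1..N} \<Longrightarrow> 0 < w n"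
begin

definition left_flux :: "complex \<Rightarrow> (nat \<Rightarrow> complex) \<Rightarrow> complex" where
  "left_flux l x = flux f x 1 - (of_real (q 1) - l * of_real (w 1)) * x 1"

definition right_flux :: "complex \<Rightarrow> (nat \<Rightarrow> complex) \<Rightarrow> complex" where
  "right_flux l x = flux f x (N-1) + (of_real (q N) - l * of_real (w N)) * x N"

text \<open>The end values are chosen so that the equation holds at \<open>1\<close> and at \<open>N\<close>.\<close>

definition extend :: "complex \<Rightarrow> (nat \<Rightarrow> complex) \<Rightarrow> nat \<Rightarrow> complex" where
  "extend l x n =
     (if n = 0 then x 1 - left_flux l x / of_real (f 0)
      else if n \<le> N then x n
      else if n = N + 1 then x N + right_flux l x / of_real (f N)
      else 0)"

lemma extend_apply: "n \<in> {1..N} \<Longrightarrow> extend l x n = x n"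
  by (simp add: extend_def)

lemma extend_cong:
  assumes "\<And>n. n \<in> {1..N} \<Longrightarrow> x n = y n"
  shows "extend l x = extend l y"
proof -
  have "x 1 = y 1" "x (1+1) = y (1+1)" "x N = y N" "x (N-1) = y (N-1)" "x (N-1+1) = y (N-1+1)"
    using assms N_ge_2 by auto
  then have "left_flux l x = left_flux l y" "right_flux l x = right_flux l y"
    by (simp_all only: left_flux_def right_flux_def flux_def)
  then show ?thesis
    using assms \<open>x 1 = y 1\<close> \<open>x N = y N\<close> by (auto simp: extend_def fun_eq_iff)
qed

lemma residual_extend:
  shows "residual f q w l (extend l x) 1 = 0" and "residual f q w l (extend l x) N = 0"
proof -
  have "flux f (extend l x) 0 = left_flux l x" "flux f (extend l x) N = right_flux l x"
    using f_nonzero[of 0] f_nonzero[of N] N_ge_2 by (simp_all add: flux_def extend_def)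
  moreover have "flux f (extend l x) 1 = flux f x 1" "flux f (extend l x) (N-1) = flux f x (N-1)"
    using N_ge_2 by (simp_all add: flux_def extend_def)
  moreover have "extend l x 1 = x 1" "extend l x N = x N"
    using N_ge_2 by (simp_all add: extend_def)
  ultimately show "residual f q w l (extend l x) 1 = 0" "residual f q w l (extend l x) N = 0"
    by (simp_all add: residual_def left_flux_def right_flux_def)
qed

lemma extend_solution:
  assumes "sl_eq f q w N l y" "\<And>n. N + 1 < n \<Longrightarrow> y n = 0"
  shows "extend l y = y"
proof
  fix n
  have "residual f q w l y 1 = 0" "residual f q w l y N = 0"
    using assms(1) N_ge_2 by (simp_all add: sl_eq_iff_residual)
  then have "left_flux l y = of_real (f 0) * (y 1 - y 0)"
    "right_flux l y = of_real (f N) * (y (N+1) - y N)"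
    by (simp_all add: residual_def left_flux_def right_flux_def flux_def algebra_simps)
  then show "extend l y n = y n"
    using assms(2)[of n] f_nonzero[of 0] f_nonzero[of N] by (auto simp: extend_def)
qed

lemma linear_extend: "Vector_Spaces.linear seq_scale seq_scale (extend l)"
proof -
  have "left_flux l (x + y) = left_flux l x + left_flux l y"
    "right_flux l (x + y) = right_flux l x + right_flux l y" for x y
    by (simp_all add: left_flux_def right_flux_def flux_def algebra_simps)
  moreover have "left_flux l (seq_scale k x) = k * left_flux l x"
    "right_flux l (seq_scale k x) = k * right_flux l x" for k x
    by (simp_all add: left_flux_def right_flux_def flux_def algebra_simps)
  ultimately show ?thesis
    by unfold_locales (auto simp: extend_def fun_eq_iff add_divide_distrib algebra_simps)
qed

end

locale sl_problem = sl_equation f q w N for f q w :: "nat \<Rightarrow> real" and N :: nat +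
  fixes z :: complex and c b :: ereal and M :: "nat \<Rightarrow> nat \<Rightarrow> complex"
  assumes c_neq_minus_infinity: "c \<noteq> -\<infinity>" and b_neq_minus_infinity: "b \<noteq> -\<infinity>"
    and bc_holds_iff: "bc_holds M f N y \<longleftrightarrow> coupled_bc f N z c b y"
begin

sublocale hermitian_pencil seq_scale "sl_form f q N z c b" "weighted_form w N" "form_domain N z c b"
  using w_pos by (rule hermitian_pencil_sl_form)

lemma green_identity_extend:
  "(\<Sum>n=1..N. residual f q w l (extend l x) n * cnj (v n)) =
    sl_form f q N z c b x v - l * weighted_form w N x v
    + left_defect f N z c (extend l x) * cnj (coupling N z v)
    - right_defect f N z b (extend l x) * cnj (v N)"
proof -
  have "sl_form f q N z c b (extend l x) v = sl_form f q N z c b x v"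
    using N_ge_2 by (rule sl_form_cong) (rule extend_apply)
  moreover have "weighted_form w N (extend l x) v = weighted_form w N x v"
    by (rule weighted_form_cong) (rule extend_apply)
  ultimately show ?thesis
    using green_identity[of N f q w l "extend l x" v z c b] N_ge_2 by simp
qed

lemma residual_extend_eigenvector:
  assumes "x \<in> eigenspace l" "n \<in> {1..N}"
  shows "residual f q w l (extend l x) n = 0"
proof (cases "n = 1 \<or> n = N")
  case True
  then show ?thesis
    using residual_extend by blast
next
  case False
  then have v: "unit_seq n \<in> form_domain N z c b" "coupling N z (unit_seq n) = 0" "unit_seq n N = 0"
    using assms(2) by (auto simp: form_domain_def unit_seq_def coupling_def)
  have "residual f q w l (extend l x) n =
      (\<Sum>k=1..N. residual f q w l (extend l x) k * cnj (unit_seq n k))"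
    using assms(2) by (simp add: unit_seq_def of_bool_def if_distrib cong: if_cong)
  also have "\<dots> = 0"
    unfolding green_identity_extend using assms(1) v by (simp add: eigenspace_def)
  finally show ?thesis .
qed

lemma coupled_bc_extend_eigenvector:
  assumes x: "x \<in> eigenspace l"
  shows "coupled_bc f N z c b (extend l x)"
proof -
  let ?y = "extend l x"
  have boundary: "left_defect f N z c ?y * cnj (coupling N z v) = right_defect f N z b ?y * cnj (v N)"
    if "v \<in> form_domain N z c b" for v
    using green_identity_extend[of l x v] residual_extend_eigenvector[OF x] x that
    by (simp add: eigenspace_def)
  have "left_defect f N z c ?y = 0" if "c \<noteq> \<infinity>"
  proof -
    have "unit_seq 1 \<in> form_domain N z c b" "coupling N z (unit_seq 1) = 1" "unit_seq 1 N = 0"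
      using that N_ge_2 by (auto simp: form_domain_def coupling_def unit_seq_def)
    then show ?thesis
      using boundary by fastforce
  qed
  moreover have "right_defect f N z b ?y = 0" if "b \<noteq> \<infinity>"
  proof -
    let ?v = "\<lambda>n. unit_seq N n - cnj z * unit_seq 1 n"
    have "?v \<in> form_domain N z c b" "coupling N z ?v = 0" "?v N = 1"
      using that N_ge_2 by (auto simp: form_domain_def coupling_def unit_seq_def)
    then show ?thesis
      using boundary by fastforce
  qed
  moreover have "?y 1 = x 1" "?y N = x N"
    using N_ge_2 by (simp_all add: extend_def)
  moreover have "x \<in> form_domain N z c b"
    using x by (simp add: eigenspace_def)
  ultimately show ?thesis
    by (auto simp: coupled_bc_def coupling_def form_domain_def)
qed

lemma solution_extends_eigenvector:
  assumes y: "y \<in> sol_space f q w N M l"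
  shows "\<exists>x\<in>eigenspace l. extend l x = y"
proof
  define x where "x n = (if n \<in> {1..N} then y n else 0)" for n
  have sl: "sl_eq f q w N l y" and bc: "coupled_bc f N z c b y"
    using y by (simp_all add: sol_space_def bc_holds_iff)
  have "extend l x = extend l y"
    by (rule extend_cong) (simp add: x_def)
  also have "\<dots> = y"
    using y sl by (intro extend_solution) (simp_all add: sol_space_def)
  finally show extend: "extend l x = y" .
  have "coupling N z x = coupling N z y" "x N = y N"
    using N_ge_2 by (simp_all add: x_def coupling_def)
  then have "x \<in> form_domain N z c b"
    using bc by (auto simp: form_domain_def coupled_bc_def x_def)
  moreover have "sl_form f q N z c b x v = l * weighted_form w N x v" if "v \<in> form_domain N z c b" for v
  proof -
    have "left_defect f N z c y * cnj (coupling N z v) = 0" "right_defect f N z b y * cnj (v N) = 0"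
      using bc that by (auto simp: coupled_bc_def form_domain_def split: if_splits)
    moreover have "(\<Sum>n=1..N. residual f q w l y n * cnj (v n)) = 0"
      using sl by (simp add: sl_eq_iff_residual)
    ultimately have "0 = sl_form f q N z c b x v - l * weighted_form w N x v"
      using green_identity_extend[of l x v] by (simp only: extend add_0_right diff_zero)
    then show ?thesis by simp
  qed
  ultimately show "x \<in> eigenspace l"
    by (simp add: eigenspace_def)
qed

lemma sol_space_eq_image: "sol_space f q w N M l = extend l ` eigenspace l"
proof -
  have "extend l x \<in> sol_space f q w N M l" if "x \<in> eigenspace l" for x
    using residual_extend_eigenvector[OF that] coupled_bc_extend_eigenvector[OF that]
    by (simp add: sol_space_def sl_eq_iff_residual bc_holds_iff extend_def)
  then show ?thesis
    using solution_extends_eigenvector by blast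
qed

lemma inj_on_extend: "inj_on (extend l) (eigenspace l)"
proof (rule inj_onI)
  fix x y assume "x \<in> eigenspace l" "y \<in> eigenspace l" and eq: "extend l x = extend l y"
  then have "x \<in> form_domain N z c b" "y \<in> form_domain N z c b"
    by (simp_all add: eigenspace_def)
  then have "x n = y n" if "n \<notin> {1..N}" for n
    using that by (simp add: form_domain_def)
  moreover have "x n = y n" if "n \<in> {1..N}" for n
    using fun_cong[OF eq, of n] that by (simp add: extend_apply)
  ultimately show "x = y"
    by blast
qed

lemma eig_mult_eq_dim: "eig_mult f q w N M l = seq.dim (eigenspace l)"
  unfolding eig_mult_def sol_space_eq_image
  by (rule linear.dim_inj_image[OF linear_extend subspace_eigenspace inj_on_extend])

lemma is_eigenvalue_iff_spectrum: "is_eigenvalue f q w N M l \<longleftrightarrow> l \<in> spectrum"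
proof -
  interpret extend: Vector_Spaces.linear seq_scale seq_scale "extend l"
    by (rule linear_extend)
  have "extend l x \<noteq> 0 \<longleftrightarrow> x \<noteq> 0" if "x \<in> eigenspace l" for x
    using extend.inj_on_iff_eq_0[OF subspace_eigenspace, of l] inj_on_extend that by auto
  then show ?thesis
    using seq.subspace_0[OF subspace_eigenspace[of l]]
    by (auto simp: is_eigenvalue_def sol_space_eq_image spectrum_def)
qed

lemma has_exactly_eigs_dim: "has_exactly_eigs f q w N M (seq.dim (form_domain N z c b))"
  by (simp add: has_exactly_eigs_def is_eigenvalue_iff_spectrum eig_mult_eq_dim finite_spectrum
      sum_dim_spectrum)

lemma sum_eig_mult_real:
  "(\<Sum>\<mu>\<in>{\<mu>. is_eigenvalue f q w N M (of_real \<mu>) \<and> P \<mu>}. eig_mult f q w N M (of_real \<mu>)) =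
     (\<Sum>l\<in>{l \<in> spectrum. P (Re l)}. seq.dim (eigenspace l))"
proof -
  have "{l \<in> spectrum. P (Re l)} =
      complex_of_real ` {\<mu>. is_eigenvalue f q w N M (of_real \<mu>) \<and> P \<mu>}"
    using spectrum_real by (force simp: is_eigenvalue_iff_spectrum elim: Reals_cases)
  then show ?thesis
    by (simp add: sum.reindex inj_on_def eig_mult_eq_dim)
qed

lemma eig_le_iff:
  assumes "n < seq.dim (form_domain N z c b)"
  shows "eig f q w N M n \<le> x \<longleftrightarrow>
    (\<exists>S. seq.subspace S \<and> S \<subseteq> form_domain N z c b \<and> n < seq.dim S \<and>
      (\<forall>v\<in>S. Re (sl_form f q N z c b v v) \<le> x * Re (weighted_form w N v v)))"
proof -
  define E where "E = {\<mu>::real. is_eigenvalue f q w N M (of_real \<mu>)}"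
  define m where "m \<mu> = eig_mult f q w N M (of_real \<mu>)" for \<mu> :: real
  have "finite E"
    using finite_vimageI[OF finite_spectrum, of complex_of_real]
    by (simp add: E_def vimage_def is_eigenvalue_iff_spectrum inj_on_def)
  have count: "eig_count_le f q w N M y = sum m {\<mu> \<in> E. \<mu> \<le> y}" for y
    by (simp add: eig_count_le_def E_def m_def)
  have "sum m E = seq.dim (form_domain N z c b)"
    using sum_eig_mult_real[of "\<lambda>_. True"] sum_dim_spectrum by (simp add: E_def m_def)
  then have "eig f q w N M n \<le> x \<longleftrightarrow> n < eig_count_le f q w N M x"
    using Min_cumulative_le_iff[OF \<open>finite E\<close>, of n m x] assms by (simp add: eig_def count E_def)
  also have "eig_count_le f q w N M x = (\<Sum>l\<in>{l \<in> spectrum. Re l \<le> x}. seq.dim (eigenspace l))"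
    unfolding eig_count_le_def by (rule sum_eig_mult_real)
  finally show ?thesis
    by (simp only: courant_fischer)
qed

end

section \<open>Monotonicity and interlacing of eigenvalues\<close>

lemma real_of_ereal_mult_mono:
  assumes "c \<le> c'" "c \<noteq> -\<infinity>" "0 \<le> t" "c' = \<infinity> \<Longrightarrow> t = 0"
  shows "real_of_ereal c * t \<le> real_of_ereal c' * t"
  using assms by (cases c; cases c') (auto simp: mult_right_mono)

lemma form_domain_antimono: "c \<le> c' \<Longrightarrow> b \<le> b' \<Longrightarrow> form_domain N z c' b' \<subseteq> form_domain N z c b"
  by (auto simp: form_domain_def)

lemma sl_form_diag_mono:
  assumes "c \<le> c'" "b \<le> b'" "c \<noteq> -\<infinity>" "b \<noteq> -\<infinity>" and "v \<in> form_domain N z c' b'"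
  shows "Re (sl_form f q N z c b v v) \<le> Re (sl_form f q N z c' b' v v)"
proof -
  have "real_of_ereal c * (cmod (coupling N z v))\<^sup>2 \<le> real_of_ereal c' * (cmod (coupling N z v))\<^sup>2"
    using assms by (intro real_of_ereal_mult_mono) (auto simp: form_domain_def)
  moreover have "real_of_ereal b * (cmod (v N))\<^sup>2 \<le> real_of_ereal b' * (cmod (v N))\<^sup>2"
    using assms by (intro real_of_ereal_mult_mono) (auto simp: form_domain_def)
  ultimately show ?thesis
    by (simp add: sl_form_diag)
qed

lemma eig_mono:
  assumes "sl_problem f w N z c b M" and "sl_problem f w N z c' b' M'"
    and le: "c \<le> c'" "b \<le> b'"
    and n: "n < N - of_bool (c' = \<infinity>) - of_bool (b' = \<infinity>)"
  shows "eig f q w N M n \<le> eig f q w N M' n"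
proof -
  interpret P: sl_problem f q w N z c b M by fact
  interpret P': sl_problem f q w N z c' b' M' by fact
  note dim = dim_form_domain[OF P.N_ge_2]
  let ?x = "eig f q w N M' n"
  obtain S where S: "seq.subspace S" "S \<subseteq> form_domain N z c' b'" "n < seq.dim S"
    "\<forall>v\<in>S. Re (sl_form f q N z c' b' v v) \<le> ?x * Re (weighted_form w N v v)"
    using P'.eig_le_iff[of n ?x] n by (auto simp: dim)
  have "Re (sl_form f q N z c b v v) \<le> ?x * Re (weighted_form w N v v)" if "v \<in> S" for v
  proof -
    have "Re (sl_form f q N z c b v v) \<le> Re (sl_form f q N z c' b' v v)"
      using that S(2) by (intro sl_form_diag_mono[OF le P.c_neq_minus_infinity P.b_neq_minus_infinity]) auto
    also have "\<dots> \<le> ?x * Re (weighted_form w N v v)"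
      using that S(4) by blast
    finally show ?thesis .
  qed
  moreover have "n < seq.dim (form_domain N z c b)"
    using n le by (auto simp: dim of_bool_def split: if_splits)
  ultimately show ?thesis
    using S form_domain_antimono[OF le] by (subst P.eig_le_iff) blast+
qed

lemma eig_interlace_hyperplane:
  assumes "sl_problem f w N z c b M" and "sl_problem f w N z c' b' M'"
    and linear: "Vector_Spaces.linear seq_scale (*) l"
    and kernel: "\<And>v. v \<in> form_domain N z c' b' \<Longrightarrow> l v = 0 \<Longrightarrow> v \<in> form_domain N z c b \<and>
      Re (sl_form f q N z c b v v) \<le> Re (sl_form f q N z c' b' v v)"
    and n: "n < seq.dim (form_domain N z c b)" "Suc n < seq.dim (form_domain N z c' b')"
  shows "eig f q w N M n \<le> eig f q w N M' (Suc n)"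
proof -
  interpret P: sl_problem f q w N z c b M by fact
  interpret P': sl_problem f q w N z c' b' M' by fact
  interpret l: Vector_Spaces.linear seq_scale "(*)" l by fact
  let ?x = "eig f q w N M' (Suc n)"
  obtain S where S: "seq.subspace S" "S \<subseteq> form_domain N z c' b'" "Suc n < seq.dim S"
    "\<forall>v\<in>S. Re (sl_form f q N z c' b' v v) \<le> ?x * Re (weighted_form w N v v)"
    using P'.eig_le_iff[OF n(2), of ?x] by auto
  let ?K = "{v \<in> S. l v = 0}"
  have "seq.subspace ?K"
    using S(1) by (simp add: seq.subspace_def l.add l.scale)
  moreover have "seq.dim S \<le> seq.dim ?K + 1"
    using seq.dim_hyperplane[OF linear S(1) order_trans[OF S(2) form_domain_subset_span]] by simp
  moreover have "Re (sl_form f q N z c b v v) \<le> ?x * Re (weighted_form w N v v)" if "v \<in> ?K" for v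
  proof -
    have "Re (sl_form f q N z c b v v) \<le> Re (sl_form f q N z c' b' v v)"
      using that S(2) kernel by blast
    also have "\<dots> \<le> ?x * Re (weighted_form w N v v)"
      using that S(4) by blast
    finally show ?thesis .
  qed
  ultimately show ?thesis
    using S(2,3) kernel by (subst P.eig_le_iff[OF n(1)]) (intro exI[of _ ?K], auto)
qed

lemma eig_interlace_coupling:
  assumes "sl_problem f w N z c b M" and "sl_problem f w N z c' b M'"
    and n: "Suc n < N - of_bool (c' = \<infinity>) - of_bool (b = \<infinity>)"
  shows "eig f q w N M n \<le> eig f q w N M' (Suc n)"
proof (rule eig_interlace_hyperplane[OF assms(1,2) linear_coupling])
  have "2 \<le> N"
    using assms(1) by (simp add: sl_problem_def sl_equation_def)
  then show "n < seq.dim (form_domain N z c b)" "Suc n < seq.dim (form_domain N z c' b)"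
    using n by (auto simp: dim_form_domain)
qed (auto simp: form_domain_def sl_form_diag)

lemma eig_interlace_endpoint:
  assumes "sl_problem f w N z c b M" and "sl_problem f w N z c b' M'"
    and n: "Suc n < N - of_bool (c = \<infinity>) - of_bool (b' = \<infinity>)"
  shows "eig f q w N M n \<le> eig f q w N M' (Suc n)"
proof (rule eig_interlace_hyperplane[OF assms(1,2) linear_coordinate[of N]])
  have "2 \<le> N"
    using assms(1) by (simp add: sl_problem_def sl_equation_def)
  then show "n < seq.dim (form_domain N z c b)" "Suc n < seq.dim (form_domain N z c b')"
    using n by (auto simp: dim_form_domain)
qed (auto simp: form_domain_def sl_form_diag)

section \<open>The boundary conditions\<close>

definition coupling_strength :: "real \<Rightarrow> real \<Rightarrow> ereal" where
  "coupling_strength a0 a = inverse (ereal (a0 - a))"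

lemma coupling_strength_eq_infinity_iff [simp]: "coupling_strength a0 a = \<infinity> \<longleftrightarrow> a = a0"
  by (simp add: coupling_strength_def)

lemma coupling_strength_neq_minus_infinity [simp]: "coupling_strength a0 a \<noteq> -\<infinity>"
  by (simp add: coupling_strength_def)

lemma real_of_coupling_strength: "real_of_ereal (coupling_strength a0 a) = 1 / (a0 - a)"
  by (simp add: coupling_strength_def divide_inverse)

lemma coupling_strength_nonneg: "a \<le> a0 \<Longrightarrow> 0 \<le> coupling_strength a0 a"
  by (simp add: coupling_strength_def)

lemma coupling_strength_nonpos: "a0 < a \<Longrightarrow> coupling_strength a0 a \<le> 0"
  by (simp add: coupling_strength_def)

lemma coupling_strength_mono:
  assumes "a \<le> a'" "a' \<le> a0 \<or> a0 < a"
  shows "coupling_strength a0 a \<le> coupling_strength a0 a'"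
  using assms by (auto simp: coupling_strength_def divide_simps)

lemma bc_holds_iff_flux:
  "bc_holds M f N y \<longleftrightarrow>
     M 0 0 * y 0 + M 0 1 * flux f y 0 + M 0 2 * y N + M 0 3 * flux f y N = 0 \<and>
     M 1 0 * y 0 + M 1 1 * flux f y 0 + M 1 2 * y N + M 1 3 * flux f y N = 0"
  by (auto simp: bc_holds_def flux_def less_2_cases_iff)

context sl_equation
begin

lemma coupled_left_condition_iff:
  defines "c \<equiv> coupling_strength (1 / f 0)"
  shows "y 0 + of_real a * flux f y 0 + cnj z * y N = 0 \<longleftrightarrow>
    (if c a = \<infinity> then coupling N z y = 0 else left_defect f N z (c a) y = 0)"
proof -
  define k where "k = complex_of_real (1 / f 0 - a)"
  have "y 1 = y 0 + of_real (1 / f 0) * flux f y 0"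
    using f_nonzero[of 0] by (simp add: flux_def)
  then have "y 0 + of_real a * flux f y 0 + cnj z * y N = coupling N z y - k * flux f y 0"
    by (simp add: coupling_def k_def algebra_simps)
  moreover have "k = 0 \<longleftrightarrow> c a = \<infinity>"
    by (auto simp: k_def c_def simp flip: of_real_diff)
  moreover have "coupling N z y - k * flux f y 0 = - k * left_defect f N z (c a) y" if "k \<noteq> 0"
  proof -
    have "left_defect f N z (c a) y = flux f y 0 - coupling N z y / k"
      by (simp add: left_defect_def c_def real_of_coupling_strength k_def)
    then show ?thesis
      using that by (simp add: right_diff_distrib)
  qed
  ultimately show ?thesis
    by (cases "k = 0") simp_all
qed

lemma sl_problem_bcA: "sl_problem f w N z (coupling_strength (1 / f 0) a) (ereal b) (bcA a b z)"
proof
  show "bc_holds (bcA a b z) f N y \<longleftrightarrow> coupled_bc f N z (coupling_strength (1 / f 0) a) (ereal b) y" for y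
    using coupled_left_condition_iff[of y a z]
    by (simp add: coupled_bc_def bc_holds_iff_flux bcA_def right_defect_def add_ac)
qed simp_all

lemma sl_problem_bcS1: "sl_problem f w N z 0 (ereal b) (bcS1 b)"
proof
  show "bc_holds (bcS1 b) f N y \<longleftrightarrow> coupled_bc f N z 0 (ereal b) y" for y
    by (auto simp: coupled_bc_def bc_holds_iff_flux bcS1_def left_defect_def right_defect_def add_ac)
qed simp_all

lemma sl_problem_bcS2: "sl_problem f w N z (coupling_strength (1 / f 0) a) \<infinity> (bcS2 a)"
proof
  show "bc_holds (bcS2 a) f N y \<longleftrightarrow> coupled_bc f N z (coupling_strength (1 / f 0) a) \<infinity> y" for y
    using coupled_left_condition_iff[of y a z]
    by (auto simp: coupled_bc_def bc_holds_iff_flux bcS2_def)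
qed simp_all

lemma has_exactly_eigs_bcA:
  "k = N - of_bool (a = 1 / f 0) \<Longrightarrow> has_exactly_eigs f q w N (bcA a b z) k"
  using sl_problem.has_exactly_eigs_dim[OF sl_problem_bcA, of q a b z]
  by (simp add: dim_form_domain[OF N_ge_2])

lemma has_exactly_eigs_bcS1: "has_exactly_eigs f q w N (bcS1 b) N"
  using sl_problem.has_exactly_eigs_dim[OF sl_problem_bcS1, of q b 0]
  by (simp add: dim_form_domain[OF N_ge_2])

lemma has_exactly_eigs_bcS2:
  "k = N - of_bool (a = 1 / f 0) - 1 \<Longrightarrow> has_exactly_eigs f q w N (bcS2 a) k"
  using sl_problem.has_exactly_eigs_dim[OF sl_problem_bcS2, of q a 0]
  by (simp add: dim_form_domain[OF N_ge_2])

lemma eig_bcA_mono_a12: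
  assumes "a \<le> a'" "a' \<le> 1 / f 0 \<or> 1 / f 0 < a" "n < N - of_bool (a' = 1 / f 0)"
  shows "eig f q w N (bcA a b z) n \<le> eig f q w N (bcA a' b z) n"
  using assms by (intro eig_mono[OF sl_problem_bcA sl_problem_bcA] coupling_strength_mono) auto

lemma eig_bcA_le_eig_bcS1:
  "1 / f 0 < a \<Longrightarrow> n < N \<Longrightarrow> eig f q w N (bcA a b z) n \<le> eig f q w N (bcS1 b) n"
  by (intro eig_mono[OF sl_problem_bcA sl_problem_bcS1] coupling_strength_nonpos) auto

lemma eig_bcS1_le_eig_bcA:
  "a \<le> 1 / f 0 \<Longrightarrow> n < N - of_bool (a = 1 / f 0) \<Longrightarrow>
    eig f q w N (bcS1 b) n \<le> eig f q w N (bcA a b z) n"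
  by (intro eig_mono[OF sl_problem_bcS1 sl_problem_bcA] coupling_strength_nonneg) auto

lemma eig_bcA_interlace_a12:
  "Suc n < N - of_bool (a' = 1 / f 0) \<Longrightarrow>
    eig f q w N (bcA a b z) n \<le> eig f q w N (bcA a' b z) (Suc n)"
  by (intro eig_interlace_coupling[OF sl_problem_bcA sl_problem_bcA]) simp

lemma eig_bcA_mono_b21:
  "b \<le> b' \<Longrightarrow> n < N - of_bool (a = 1 / f 0) \<Longrightarrow>
    eig f q w N (bcA a b z) n \<le> eig f q w N (bcA a b' z) n"
  by (intro eig_mono[OF sl_problem_bcA sl_problem_bcA]) auto

lemma eig_bcA_le_eig_bcS2:
  "Suc n < N - of_bool (a = 1 / f 0) \<Longrightarrow> eig f q w N (bcA a b z) n \<le> eig f q w N (bcS2 a) n"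
  by (intro eig_mono[OF sl_problem_bcA sl_problem_bcS2]) auto

lemma eig_bcS2_interlace:
  "Suc n < N - of_bool (a = 1 / f 0) \<Longrightarrow> eig f q w N (bcS2 a) n \<le> eig f q w N (bcA a b z) (Suc n)"
  by (intro eig_interlace_endpoint[OF sl_problem_bcS2 sl_problem_bcA]) simp

end

theorem theorem3p2:
  fixes f q w :: "nat \<Rightarrow> real" and N :: nat and z :: complex
  assumes hN: "N \<ge> 2"
    and hf: "\<forall>n\<le>N. f n \<noteq> 0"
    and hw: "\<forall>n\<in>{1..N}. w n > 0"
  shows
    "(\<forall>a12 b21. (a12 \<noteq> 1 / f 0 \<longrightarrow> has_exactly_eigs f q w N (bcA a12 b21 z) N)
               \<and> (a12 = 1 / f 0 \<longrightarrow> has_exactly_eigs f q w N (bcA a12 b21 z) (N - 1)))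
     \<and> (\<forall>b21. has_exactly_eigs f q w N (bcS1 b21) N)
     \<and> (\<forall>a12. (a12 \<noteq> 1 / f 0 \<longrightarrow> has_exactly_eigs f q w N (bcS2 a12) (N - 1))
               \<and> (a12 = 1 / f 0 \<longrightarrow> has_exactly_eigs f q w N (bcS2 a12) (N - 2)))
     \<and> (\<forall>b21 a1 a2 a3 a4. a1 < a2 \<and> a2 \<le> 1 / f 0 \<and> 1 / f 0 < a3 \<and> a3 < a4 \<longrightarrow>
          (\<forall>n. n \<le> N - 2 \<longrightarrow>
              eig f q w N (bcA a3 b21 z) n \<le> eig f q w N (bcA a4 b21 z) n
            \<and> eig f q w N (bcA a4 b21 z) n \<le> eig f q w N (bcS1 b21) n
            \<and> eig f q w N (bcS1 b21) n \<le> eig f q w N (bcA a1 b21 z) n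
            \<and> eig f q w N (bcA a1 b21 z) n \<le> eig f q w N (bcA a2 b21 z) n
            \<and> eig f q w N (bcA a2 b21 z) n \<le> eig f q w N (bcA a3 b21 z) (n + 1))
        \<and> eig f q w N (bcA a3 b21 z) (N - 1) \<le> eig f q w N (bcA a4 b21 z) (N - 1)
        \<and> eig f q w N (bcA a4 b21 z) (N - 1) \<le> eig f q w N (bcS1 b21) (N - 1)
        \<and> eig f q w N (bcS1 b21) (N - 1) \<le> eig f q w N (bcA a1 b21 z) (N - 1)
        \<and> (a2 < 1 / f 0 \<longrightarrow>
              eig f q w N (bcA a1 b21 z) (N - 1) \<le> eig f q w N (bcA a2 b21 z) (N - 1)))
     \<and> (\<forall>a12 b1 b2. b1 < b2 \<longrightarrow>
          (\<forall>n. n + 3 \<le> N \<longrightarrow>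
              eig f q w N (bcA a12 b1 z) n \<le> eig f q w N (bcA a12 b2 z) n
            \<and> eig f q w N (bcA a12 b2 z) n \<le> eig f q w N (bcS2 a12) n
            \<and> eig f q w N (bcS2 a12) n \<le> eig f q w N (bcA a12 b1 z) (n + 1))
        \<and> eig f q w N (bcA a12 b1 z) (N - 2) \<le> eig f q w N (bcA a12 b2 z) (N - 2)
        \<and> (a12 \<noteq> 1 / f 0 \<longrightarrow>
              eig f q w N (bcA a12 b2 z) (N - 2) \<le> eig f q w N (bcS2 a12) (N - 2)
            \<and> eig f q w N (bcS2 a12) (N - 2) \<le> eig f q w N (bcA a12 b1 z) (N - 1)
            \<and> eig f q w N (bcA a12 b1 z) (N - 1) \<le> eig f q w N (bcA a12 b2 z) (N - 1)))"
proof -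
  interpret sl_equation f q w N
    using assms by unfold_locales auto
  have N_minus_1: "N - Suc 0 = Suc (N - 2)"
    using hN by simp
  show ?thesis
  proof (intro conjI, goal_cases count_A count_S1 count_S2 order_in_a12 order_in_b21)
    case count_A show ?case by (simp add: has_exactly_eigs_bcA)
  next
    case count_S1 show ?case by (simp add: has_exactly_eigs_bcS1)
  next
    case count_S2 show ?case by (simp add: has_exactly_eigs_bcS2)
  next
    case order_in_a12 show ?case using hN
      by (auto simp: N_minus_1 intro!: eig_bcA_mono_a12 eig_bcA_le_eig_bcS1 eig_bcS1_le_eig_bcA
          eig_bcA_interlace_a12)
  next
    case order_in_b21 show ?case using hN
      by (auto simp: N_minus_1 intro!: eig_bcA_mono_b21 eig_bcA_le_eig_bcS2 eig_bcS2_interlace)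
  qed
qed

end
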